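(* Let $(A,\pi A,F)$ be a complete discrete valuation ring of mixed characteristic $(0,p)$ with finite residue field $F=A/\pi A$. Let $R=A[X_1,\ldots,X_n]$ be standard $\mathbb{N}^n$-graded, let $I$ be a $\mathfrak{C}$-monomial ideal of $R$, let $i\ge 0$, and let $M=H^i_I(R)=\bigoplus_{\underline{u}\in\mathbb{Z}^n}M_{\underline{u}}$. Let $s$ be the maximum of all exponents $\beta\geq 1$ such that $A/\pi^{\beta}A$ occurs as a direct summand in the decomposition of $\Gamma_\pi(M_{\underline{u}})$ for some $\underline{u}\in\mathbb{Z}^n$ (this maximum is finite; $s=0$ if there are no such summands), and for each $\underline{u}\in\mathbb{Z}^n$ let $l(\underline{u}),\alpha_1(\underline{u}),\ldots,\alpha_s(\underline{u})\ge 0$ be the finite numbers with $$\Gamma_{\pi}(M_{\underline{u}})\cong E_A\left(\frac{A}{\pi A}\right)^{l(\underline{u})}\oplus\left(\bigoplus_{j=1}^{s}\left(\frac{A}{\pi^jA}\right)^{\alpha_j(\underline{u})}\right)$$ as $A$-modules (some $\alpha_j(\underline{u})$ may be $0$). Let $1\le j\le s$. Then for each subset $U\subseteq\{1,\ldots,n\}$ the function $\underline{u}\mapsto\alpha_j(\underline{u})$ is constant on the block $\mathcal{B}(U)$.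
   Context: Standard $\mathbb{N}^n$-grading: $\deg a=\underline{0}$ for $a\in A$ and $\deg X_j=e_j$, the $j$-th standard basis vector. An ideal $I$ of $R$ is $\mathfrak{C}$-monomial if it can be generated by elements of the form $a\,m$, where $a\in A$ (not necessarily a unit) and $m$ is a monomial in $X_1,\ldots,X_n$. For such $I$ the local cohomology module $H^i_I(R)$ carries a natural $\mathbb{Z}^n$-grading, and $M_{\underline{u}}$ denotes its component (an $A$-module) of degree $\underline{u}$. For an $A$-module $N$, $\Gamma_\pi(N)=\{x\in N:\pi^k x=0\text{ for some }k\ge 0\}$. $E_A(A/\pi A)$ is the injective hull of $A/\pi A$ over $A$. Recalled (may be taken as known): for each $\underline{u}\in\mathbb{Z}^n$ there are finite numbers $l(\underline{u}),t(\underline{u})\ge0$ and $\beta_j(\underline{u})\ge 1$ with $\Gamma_{\pi}(M_{\underline{u}})\cong E_A(A/\pi A)^{l(\underline{u})}\oplus\bigoplus_{j=1}^{t(\underline{u})}A/\pi^{\beta_j(\underline{u})}A$, and the set of all $\beta_j(\underline{u})$, over all $\underline{u}\in\mathbb{Z}^n$ and $1\le j\le t(\underline{u})$, is bounded; $s=\max\{\beta_j(\underline{u})\mid 1\le j\le t(\underline{u}),\ \underline{u}\in\mathbb{Z}^n\}$, and $\alpha_j(\underline{u})$ is the number of summands isomorphic to $A/\pi^jA$. Blocks: for $U\subseteq\{1,\ldots,n\}$, $\mathcal{B}(U)=\{\underline{u}\in\mathbb{Z}^n: u_k\ge 0\text{ if }k\in U,\ u_k\le -1\text{ if }k\notin U\}$.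 *)

theory Defs
  imports "HOL-Algebra.Algebra" "HOL-Algebra.Algebraic_Closure_Type" "HOL-Library.Poly_Mapping"
begin

section \<open>Complete discrete valuation rings of mixed characteristic\<close>

text \<open>The characteristic is the non-negative generator of the kernel of the map from the integers.\<close>

definition has_char :: "('a, 'm) ring_scheme \<Rightarrow> nat \<Rightarrow> bool" where
  "has_char A c \<longleftrightarrow> (\<forall>k::nat. add_pow A k \<one>\<^bsub>A\<^esub> = \<zero>\<^bsub>A\<^esub> \<longleftrightarrow> c dvd k)"

definition discrete_valuation_ring :: "('a, 'm) ring_scheme \<Rightarrow> 'a \<Rightarrow> bool" where
  "discrete_valuation_ring A \<pi> \<longleftrightarrow>
     principal_domain A \<and> \<pi> \<in> carrier A \<and> \<pi> \<noteq> \<zero>\<^bsub>A\<^esub> \<and>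
     (\<forall>J. maximalideal J A \<longleftrightarrow> J = PIdl\<^bsub>A\<^esub> \<pi>)"

text \<open>Bijectivity of the canonical map from \<open>A\<close> to the inverse limit of the rings \<open>A/\<pi>\<^sup>kA\<close>;
  uniqueness of \<open>y\<close> is separatedness.\<close>

definition adically_complete :: "('a, 'm) ring_scheme \<Rightarrow> 'a \<Rightarrow> bool" where
  "adically_complete A \<pi> \<longleftrightarrow>
     (\<forall>x::nat \<Rightarrow> 'a.
        (\<forall>k. x k \<in> carrier A) \<and>
        (\<forall>k. x (Suc k) \<ominus>\<^bsub>A\<^esub> x k \<in> PIdl\<^bsub>A\<^esub> (\<pi> [^]\<^bsub>A\<^esub> k)) \<longrightarrow>
        (\<exists>!y. y \<in> carrier A \<and> (\<forall>k. y \<ominus>\<^bsub>A\<^esub> x k \<in> PIdl\<^bsub>A\<^esub> (\<pi> [^]\<^bsub>A\<^esub> k))))"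

definition complete_dvr_mixed_char :: "('a, 'm) ring_scheme \<Rightarrow> 'a \<Rightarrow> nat \<Rightarrow> bool" where
  "complete_dvr_mixed_char A \<pi> p \<longleftrightarrow>
     discrete_valuation_ring A \<pi> \<and> adically_complete A \<pi> \<and>
     has_char A 0 \<and> Factorial_Ring.prime p \<and> has_char (A Quot (PIdl\<^bsub>A\<^esub> \<pi>)) p"


section \<open>Modules\<close>

definition mod_hom ::
    "('a, 'k) ring_scheme \<Rightarrow> ('a, 'b, 'm) module_scheme \<Rightarrow> ('a, 'c, 'n) module_scheme \<Rightarrow> ('b \<Rightarrow> 'c) set"
  where
  "mod_hom A M N =
     {h. h \<in> carrier M \<rightarrow> carrier N \<and>
         (\<forall>x\<in>carrier M. \<forall>y\<in>carrier M. h (x \<oplus>\<^bsub>M\<^esub> y) = h x \<oplus>\<^bsub>N\<^esub> h y) \<and>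
         (\<forall>a\<in>carrier A. \<forall>x\<in>carrier M. h (a \<odot>\<^bsub>M\<^esub> x) = a \<odot>\<^bsub>N\<^esub> h x)}"

definition mod_iso ::
    "('a, 'k) ring_scheme \<Rightarrow> ('a, 'b, 'm) module_scheme \<Rightarrow> ('a, 'c, 'n) module_scheme \<Rightarrow> bool"
  where
  "mod_iso A M N \<longleftrightarrow> (\<exists>h\<in>mod_hom A M N. bij_betw h (carrier M) (carrier N))"

text \<open>The record type \<open>module\<close> inherits the fields \<open>mult\<close> and \<open>one\<close> from \<open>ring\<close>; the locale
  \<open>module\<close> ignores them and they are left undefined below.\<close>

definition regular_module :: "('a, 'k) ring_scheme \<Rightarrow> ('a, 'a) module" where
  "regular_module A =
     \<lparr>carrier = carrier A, monoid.mult = undefined, one = undefined,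
      ring.zero = \<zero>\<^bsub>A\<^esub>, add = add A, module.smult = monoid.mult A\<rparr>"

definition quot_module :: "('a, 'b, 'm) module_scheme \<Rightarrow> 'b set \<Rightarrow> ('a, 'b set) module" where
  "quot_module M N =
     \<lparr>carrier = a_rcosets\<^bsub>M\<^esub> N, monoid.mult = undefined, one = undefined,
      ring.zero = N, add = set_add M,
      module.smult = (\<lambda>a Y. \<Union>y\<in>Y. N +>\<^bsub>M\<^esub> (a \<odot>\<^bsub>M\<^esub> y))\<rparr>"

definition direct_sum :: "'i set \<Rightarrow> ('i \<Rightarrow> ('a, 'b) module) \<Rightarrow> ('a, 'i \<Rightarrow> 'b) module" where
  "direct_sum I M =
     \<lparr>carrier = {x \<in> (\<Pi>\<^sub>E i\<in>I. carrier (M i)). finite {i \<in> I. x i \<noteq> \<zero>\<^bsub>M i\<^esub>}},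
      monoid.mult = undefined, one = undefined,
      ring.zero = (\<lambda>i\<in>I. \<zero>\<^bsub>M i\<^esub>),
      add = (\<lambda>x y. \<lambda>i\<in>I. x i \<oplus>\<^bsub>M i\<^esub> y i),
      module.smult = (\<lambda>a x. \<lambda>i\<in>I. a \<odot>\<^bsub>M i\<^esub> x i)\<rparr>"

definition direct_sum2 :: "('a, 'b) module \<Rightarrow> ('a, 'c) module \<Rightarrow> ('a, 'b \<times> 'c) module" where
  "direct_sum2 M N =
     \<lparr>carrier = carrier M \<times> carrier N, monoid.mult = undefined, one = undefined,
      ring.zero = (\<zero>\<^bsub>M\<^esub>, \<zero>\<^bsub>N\<^esub>),
      add = (\<lambda>x y. (fst x \<oplus>\<^bsub>M\<^esub> fst y, snd x \<oplus>\<^bsub>N\<^esub> snd y)),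
      module.smult = (\<lambda>a x. (a \<odot>\<^bsub>M\<^esub> fst x, a \<odot>\<^bsub>N\<^esub> snd x))\<rparr>"

definition restrict_scalars :: "('a \<Rightarrow> 'r) \<Rightarrow> ('r, 'b) module \<Rightarrow> ('a, 'b) module" where
  "restrict_scalars h M =
     \<lparr>carrier = carrier M, monoid.mult = undefined, one = undefined,
      ring.zero = \<zero>\<^bsub>M\<^esub>, add = add M, module.smult = (\<lambda>a. module.smult M (h a))\<rparr>"

definition direct_summand ::
    "('a, 'k) ring_scheme \<Rightarrow> ('a, 'c) module \<Rightarrow> ('a, 'b) module \<Rightarrow> bool" where
  "direct_summand A P N \<longleftrightarrow>
     (\<exists>K L. submodule K A N \<and> submodule L A N \<and>
        K \<inter> L = {\<zero>\<^bsub>N\<^esub>} \<and> K <+>\<^bsub>N\<^esub> L = carrier N \<and>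
        mod_iso A (N\<lparr>carrier := K\<rparr>) P)"

text \<open>The extension property is tested on modules \<open>M\<close> carried by the type of the ring itself.
  HOL cannot quantify over all types inside a definition; these \<open>M\<close> include \<open>A\<close> as a module over
  itself, so by Baer's criterion nothing is lost.\<close>

definition injective_module :: "('a, 'k) ring_scheme \<Rightarrow> ('a, 'e) module \<Rightarrow> bool" where
  "injective_module A E \<longleftrightarrow>
     module A E \<and>
     (\<forall>(M :: ('a, 'a) module) N. module A M \<and> submodule N A M \<longrightarrow>
        (\<forall>h \<in> mod_hom A (M\<lparr>carrier := N\<rparr>) E. \<exists>g \<in> mod_hom A M E. \<forall>x\<in>N. g x = h x))"

definition injective_hull ::
    "('a, 'k) ring_scheme \<Rightarrow> ('a, 'b) module \<Rightarrow> ('a, 'e) module \<Rightarrow> bool" where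
  "injective_hull A N E \<longleftrightarrow>
     injective_module A E \<and>
     (\<exists>\<iota> \<in> mod_hom A N E. inj_on \<iota> (carrier N) \<and>
        (\<forall>L. submodule L A E \<and> L \<inter> \<iota> ` carrier N = {\<zero>\<^bsub>E\<^esub>} \<longrightarrow> L = {\<zero>\<^bsub>E\<^esub>}))"

definition cyclic_quot :: "('a, 'k) ring_scheme \<Rightarrow> 'a \<Rightarrow> nat \<Rightarrow> ('a, 'a set) module" where
  "cyclic_quot A \<pi> j = quot_module (regular_module A) (PIdl\<^bsub>A\<^esub> (\<pi> [^]\<^bsub>A\<^esub> j))"

definition torsion_part :: "('a, 'k) ring_scheme \<Rightarrow> 'a \<Rightarrow> ('a, 'b) module \<Rightarrow> ('a, 'b) module" where
  "torsion_part A \<pi> N =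
     N\<lparr>carrier := {x \<in> carrier N. \<exists>k::nat. (\<pi> [^]\<^bsub>A\<^esub> k) \<odot>\<^bsub>N\<^esub> x = \<zero>\<^bsub>N\<^esub>}\<rparr>"

text \<open>\<open>E\<^sup>l \<oplus> \<Oplus>\<^bsub>j=1..s\<^esub> (A/\<pi>\<^sup>jA)\<^bsup>\<alpha> j\<^esup>\<close>\<close>

definition torsion_model ::
    "('a, 'k) ring_scheme \<Rightarrow> 'a \<Rightarrow> ('a, 'e) module \<Rightarrow> nat \<Rightarrow> nat \<Rightarrow> (nat \<Rightarrow> nat) \<Rightarrow>
     ('a, (nat \<Rightarrow> 'e) \<times> (nat \<times> nat \<Rightarrow> 'a set)) module" where
  "torsion_model A \<pi> E l s \<alpha> =
     direct_sum2 (direct_sum {..<l} (\<lambda>_. E))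
       (direct_sum (SIGMA j:{1..s}. {..<\<alpha> j}) (\<lambda>(j, _). cyclic_quot A \<pi> j))"


section \<open>The multigraded polynomial ring and C-monomial ideals\<close>

text \<open>Polynomials in the variables \<open>X\<^sub>1, X\<^sub>2, \<dots>\<close> are finitely supported maps from exponents to
  coefficients; \<open>A[X\<^sub>1, \<dots>, X\<^sub>n]\<close> is the subring of those involving only \<open>X\<^sub>1, \<dots>, X\<^sub>n\<close>.\<close>

type_synonym 'a mpol = "(nat \<Rightarrow>\<^sub>0 nat) \<Rightarrow>\<^sub>0 'a"

definition poly_ring :: "nat \<Rightarrow> 'a::idom mpol ring" where
  "poly_ring n = ring_of_type_algebra
     \<lparr>carrier := {f. \<forall>m\<in>Poly_Mapping.keys f. Poly_Mapping.keys m \<subseteq> {1..n}}\<rparr>"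

definition const_pol :: "'a::idom \<Rightarrow> 'a mpol" where
  "const_pol a = Poly_Mapping.single 0 a"

definition multidegrees :: "nat \<Rightarrow> (nat \<Rightarrow> int) set" where
  "multidegrees n = {1..n} \<rightarrow>\<^sub>E UNIV"

definition poly_comp :: "nat \<Rightarrow> (nat \<Rightarrow> int) \<Rightarrow> 'a::idom mpol set" where
  "poly_comp n d = {f \<in> carrier (poly_ring n).
     \<forall>m\<in>Poly_Mapping.keys f. \<forall>k\<in>{1..n}. int (Poly_Mapping.lookup m k) = d k}"

definition C_monomial :: "nat \<Rightarrow> 'a::idom mpol set \<Rightarrow> bool" where
  "C_monomial n I \<longleftrightarrow>
     (\<exists>G \<subseteq> {Poly_Mapping.single m a | m a. Poly_Mapping.keys m \<subseteq> {1..n}}.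
        I = Idl\<^bsub>poly_ring n\<^esub> G)"

definition block :: "nat \<Rightarrow> nat set \<Rightarrow> (nat \<Rightarrow> int) set" where
  "block n U = {u \<in> multidegrees n. \<forall>k\<in>{1..n}. (k \<in> U \<longrightarrow> u k \<ge> 0) \<and> (k \<notin> U \<longrightarrow> u k \<le> -1)}"


section \<open>Local cohomology of the polynomial ring and its grading\<close>

text \<open>As the polynomial ring is a domain, its localization at the powers of \<open>f \<noteq> 0\<close> is a subring
  of the field of fractions, regarded as a module over the polynomial ring.\<close>

definition localization :: "nat \<Rightarrow> 'a::idom mpol \<Rightarrow> ('a mpol, 'a mpol fract) module" where
  "localization n f =
     \<lparr>carrier = {Fract g (f ^ k) | g k. g \<in> carrier (poly_ring n)},
      monoid.mult = (*), one = 1, ring.zero = 0, add = (+),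
      module.smult = (\<lambda>r x. Fract r 1 * x)\<rparr>"

text \<open>For homogeneous \<open>f\<close> of degree \<open>d\<close> the fraction \<open>g/f\<^sup>k\<close> has degree \<open>deg g - kd\<close>.\<close>

definition localization_comp ::
    "nat \<Rightarrow> 'a::idom mpol \<Rightarrow> (nat \<Rightarrow> int) \<Rightarrow> 'a mpol fract set" where
  "localization_comp n f u =
     {Fract g (f ^ k) | g k d. f \<in> poly_comp n d \<and> g \<in> poly_comp n (\<lambda>i. u i + int k * d i)}"

text \<open>Local cohomology is the cohomology of the Cech complex on a list \<open>fs\<close> of nonzero
  homogeneous generators of the ideal. Its term in degree \<open>i\<close> is the direct sum, over the
  \<open>i\<close>-element sets \<open>S\<close> of positions in \<open>fs\<close>, of the localizations at the product of the \<open>fs ! j\<close>,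
  \<open>j \<in> S\<close>; the grading of these localizations induces the one on the cohomology.\<close>

definition cech_index :: "'a list \<Rightarrow> nat \<Rightarrow> nat set set" where
  "cech_index fs i = {S. S \<subseteq> {..<length fs} \<and> card S = i}"

definition gen_prod :: "'a::idom mpol list \<Rightarrow> nat set \<Rightarrow> 'a mpol" where
  "gen_prod fs S = (\<Prod>j\<in>S. fs ! j)"

definition cech :: "nat \<Rightarrow> 'a::idom mpol list \<Rightarrow> nat \<Rightarrow>
    ('a mpol, nat set \<Rightarrow> 'a mpol fract) module" where
  "cech n fs i = direct_sum (cech_index fs i) (\<lambda>S. localization n (gen_prod fs S))"

definition cech_diff :: "'a::idom mpol list \<Rightarrow> nat \<Rightarrow>
    (nat set \<Rightarrow> 'a mpol fract) \<Rightarrow> (nat set \<Rightarrow> 'a mpol fract)" where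
  "cech_diff fs i c =
     (\<lambda>T\<in>cech_index fs (Suc i). \<Sum>j\<in>T. (-1) ^ card {k \<in> T. k < j} * c (T - {j}))"

definition cocycles :: "nat \<Rightarrow> 'a::idom mpol list \<Rightarrow> nat \<Rightarrow> (nat set \<Rightarrow> 'a mpol fract) set" where
  "cocycles n fs i = {c \<in> carrier (cech n fs i). cech_diff fs i c = \<zero>\<^bsub>cech n fs (Suc i)\<^esub>}"

definition coboundaries :: "nat \<Rightarrow> 'a::idom mpol list \<Rightarrow> nat \<Rightarrow> (nat set \<Rightarrow> 'a mpol fract) set" where
  "coboundaries n fs i =
     (case i of 0 \<Rightarrow> {\<zero>\<^bsub>cech n fs 0\<^esub>} | Suc k \<Rightarrow> cech_diff fs k ` carrier (cech n fs k))"

definition local_cohomology :: "nat \<Rightarrow> 'a::idom mpol list \<Rightarrow> nat \<Rightarrow>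
    ('a mpol, (nat set \<Rightarrow> 'a mpol fract) set) module" where
  "local_cohomology n fs i =
     quot_module ((cech n fs i)\<lparr>carrier := cocycles n fs i\<rparr>) (coboundaries n fs i)"

definition local_cohomology_comp :: "nat \<Rightarrow> 'a::idom mpol list \<Rightarrow> nat \<Rightarrow> (nat \<Rightarrow> int) \<Rightarrow>
    ('a, (nat set \<Rightarrow> 'a mpol fract) set) module" where
  "local_cohomology_comp n fs i u =
     (restrict_scalars const_pol (local_cohomology n fs i))
       \<lparr>carrier := {coboundaries n fs i +>\<^bsub>cech n fs i\<^esub> c | c.
          c \<in> cocycles n fs i \<and>
          (\<forall>S\<in>cech_index fs i. c S \<in> localization_comp n (gen_prod fs S) u)}\<rparr>"

definition homogeneous_generators :: "nat \<Rightarrow> 'a::idom mpol set \<Rightarrow> 'a mpol list \<Rightarrow> bool" where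
  "homogeneous_generators n I fs \<longleftrightarrow>
     (\<forall>f\<in>set fs. f \<noteq> 0 \<and> (\<exists>d\<in>multidegrees n. f \<in> poly_comp n d)) \<and>
     I = Idl\<^bsub>poly_ring n\<^esub> (set fs)"

end

theory Submission
  imports Defs
begin

text \<open>For \<open>u, v\<close> in the same block, multiplication by the Laurent monomial \<open>X\<^sup>v\<^sup>-\<^sup>u\<close> maps the
  degree \<open>u\<close> part of each localization in the Cech complex onto the degree \<open>v\<close> part: where \<open>v\<close> is
  negative so is \<open>u\<close>, hence the inverted monomial involves the variable in question and a larger
  power of it serves as denominator. So \<open>M\<^sub>u\<close> and \<open>M\<^sub>v\<close> are isomorphic \<open>A\<close>-modules.

  It remains to recover the \<open>\<alpha>\<^sub>j\<close> from \<open>T = E\<^sup>l \<oplus> Q\<close>, where \<open>Q\<close> is the sum of \<open>\<alpha>\<^sub>j\<close> copies of each \<open>A/\<pi>\<^sup>jA\<close>.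
  As \<open>E\<close> is divisible and \<open>\<pi>\<^sup>s\<close> kills \<open>Q\<close>, we have \<open>\<pi>\<^sup>s T = E\<^sup>l\<close>, so an isomorphism of two such
  modules induces one of their reduced parts \<open>Q\<close>. If \<open>A/\<pi>\<close> has \<open>q\<close> elements, \<open>\<pi>\<^sup>k Q\<close> has
  \<open>q\<close> to the power \<open>\<Sum>\<^sub>j \<alpha>\<^sub>j max(j - k, 0)\<close> of them, and the \<open>\<alpha>\<^sub>j\<close> are the second differences of these
  exponents in \<open>k\<close>.\<close>

section \<open>Modules and their subquotients\<close>

lemma mod_hom_zero:
  assumes "module A M" "module A N" "h \<in> mod_hom A M N"
  shows "h \<zero>\<^bsub>M\<^esub> = \<zero>\<^bsub>N\<^esub>"
proof -
  interpret M: module A M by fact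
  interpret N: module A N by fact
  have "h \<zero>\<^bsub>M\<^esub> = h (\<zero>\<^bsub>A\<^esub> \<odot>\<^bsub>M\<^esub> \<zero>\<^bsub>M\<^esub>)" by simp
  also have "\<dots> = \<zero>\<^bsub>A\<^esub> \<odot>\<^bsub>N\<^esub> h \<zero>\<^bsub>M\<^esub>"
    using assms(3) M.zero_closed by (simp add: mod_hom_def del: M.smult_r_null M.smult_l_null)
  also have "\<dots> = \<zero>\<^bsub>N\<^esub>"
    using assms(3) M.zero_closed by (auto simp: mod_hom_def Pi_iff)
  finally show ?thesis .
qed

text \<open>Sums and multiples in N are computed on preimages; closure of M keeps these results in
  the domain on which the inverse undoes \<open>h\<close>.\<close>

lemma mod_iso_sym:
  assumes "module A M" "mod_iso A M N"
  shows "mod_iso A N M"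
proof -
  interpret M: module A M by fact
  obtain h where h: "h \<in> mod_hom A M N" "bij_betw h (carrier M) (carrier N)"
    using assms(2) by (auto simp: mod_iso_def)
  define g where "g = the_inv_into (carrier M) h"
  have inj: "inj_on h (carrier M)" and im: "h ` carrier M = carrier N"
    using h(2) by (auto simp: bij_betw_def)
  have gh: "g (h x) = x" if "x \<in> carrier M" for x
    using inj that by (simp add: g_def the_inv_into_f_f)
  have hom: "h (x \<oplus>\<^bsub>M\<^esub> y) = h x \<oplus>\<^bsub>N\<^esub> h y" "h (a \<odot>\<^bsub>M\<^esub> x) = a \<odot>\<^bsub>N\<^esub> h x"
    if "x \<in> carrier M" "y \<in> carrier M" "a \<in> carrier A" for x y a
    using h(1) that by (auto simp: mod_hom_def)
  have "g \<in> mod_hom A N M"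
    unfolding mod_hom_def
  proof (intro CollectI conjI ballI)
    show "g \<in> carrier N \<rightarrow> carrier M" using gh im by (metis (no_types, lifting) Pi_I imageE)
    show "g (x \<oplus>\<^bsub>N\<^esub> y) = g x \<oplus>\<^bsub>M\<^esub> g y" if xy: "x \<in> carrier N" "y \<in> carrier N" for x y
    proof -
      obtain x' y' where *: "x' \<in> carrier M" "y' \<in> carrier M" "x = h x'" "y = h y'"
        using xy im by blast
      then have "x \<oplus>\<^bsub>N\<^esub> y = h (x' \<oplus>\<^bsub>M\<^esub> y')" by (simp add: hom(1)[OF _ _ M.R.zero_closed])
      with * show ?thesis by (simp add: gh)
    qed
    show "g (a \<odot>\<^bsub>N\<^esub> x) = a \<odot>\<^bsub>M\<^esub> g x" if ax: "a \<in> carrier A" "x \<in> carrier N" for a x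
    proof -
      obtain x' where *: "x' \<in> carrier M" "x = h x'"
        using ax im by blast
      then have "a \<odot>\<^bsub>N\<^esub> x = h (a \<odot>\<^bsub>M\<^esub> x')" using ax by (simp add: hom(2)[OF _ M.zero_closed])
      with * ax show ?thesis by (simp add: gh)
    qed
  qed
  moreover have "bij_betw g (carrier N) (carrier M)"
    unfolding g_def using h(2) by (rule bij_betw_the_inv_into)
  ultimately show ?thesis by (auto simp: mod_iso_def)
qed

lemma mod_iso_trans:
  assumes "mod_iso A M N" "mod_iso A N P"
  shows "mod_iso A M P"
proof -
  obtain h g where h: "h \<in> mod_hom A M N" "bij_betw h (carrier M) (carrier N)"
    and g: "g \<in> mod_hom A N P" "bij_betw g (carrier N) (carrier P)"
    using assms by (auto simp: mod_iso_def)
  have "g \<circ> h \<in> mod_hom A M P"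
    using h(1) g(1) by (auto simp: mod_hom_def Pi_iff)
  with bij_betw_trans[OF h(2) g(2)] show ?thesis by (auto simp: mod_iso_def)
qed

text \<open>Exponents add up: if \<pi>^k kills a and \<pi>^m kills b, then \<pi>^(m+k) kills both
  and hence their sum.\<close>

lemma torsion_part_submodule:
  assumes "module A N" "\<pi> \<in> carrier A"
  shows "submodule (carrier (torsion_part A \<pi> N)) A N"
proof -
  interpret N: module A N by fact
  have pw: "\<pi> [^]\<^bsub>A\<^esub> k \<in> carrier A" for k :: nat using assms(2) by simp
  show ?thesis
    unfolding torsion_part_def
  proof (rule N.submoduleI, goal_cases)
    case (3 a)
    then show ?case using pw by (auto simp: N.smult_r_minus)
  next
    case (4 a b)
    then have *: "a \<in> carrier N" "b \<in> carrier N" by auto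
    from 4 obtain k m :: nat where km: "(\<pi> [^]\<^bsub>A\<^esub> k) \<odot>\<^bsub>N\<^esub> a = \<zero>\<^bsub>N\<^esub>" "(\<pi> [^]\<^bsub>A\<^esub> m) \<odot>\<^bsub>N\<^esub> b = \<zero>\<^bsub>N\<^esub>"
      by auto
    have "(\<pi> [^]\<^bsub>A\<^esub> (m + k)) \<odot>\<^bsub>N\<^esub> a = \<zero>\<^bsub>N\<^esub>"
      using pw * km by (simp add: N.smult_assoc1 flip: N.R.nat_pow_mult[OF assms(2)])
    moreover have "(\<pi> [^]\<^bsub>A\<^esub> (k + m)) \<odot>\<^bsub>N\<^esub> b = \<zero>\<^bsub>N\<^esub>"
      using pw * km by (simp add: N.smult_assoc1 flip: N.R.nat_pow_mult[OF assms(2)])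
    ultimately have "(\<pi> [^]\<^bsub>A\<^esub> (m + k)) \<odot>\<^bsub>N\<^esub> (a \<oplus>\<^bsub>N\<^esub> b) = \<zero>\<^bsub>N\<^esub>"
      using pw * by (simp add: N.smult_r_distr add.commute)
    then show ?case using * by auto
  next
    case (5 a x)
    then obtain k :: nat where x: "x \<in> carrier N" "(\<pi> [^]\<^bsub>A\<^esub> k) \<odot>\<^bsub>N\<^esub> x = \<zero>\<^bsub>N\<^esub>" by auto
    have "(\<pi> [^]\<^bsub>A\<^esub> k) \<odot>\<^bsub>N\<^esub> (a \<odot>\<^bsub>N\<^esub> x) = a \<odot>\<^bsub>N\<^esub> ((\<pi> [^]\<^bsub>A\<^esub> k) \<odot>\<^bsub>N\<^esub> x)"
      using 5(1) pw[of k] x(1) N.R.m_comm[OF 5(1) pw[of k]]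
      by (simp only: N.smult_assoc1[symmetric])
    then show ?case using 5(1) x by auto
  qed (use pw in auto)
qed

lemma torsion_part_module:
  assumes "module A N" "\<pi> \<in> carrier A"
  shows "module A (torsion_part A \<pi> N)"
  using submodule.submodule_is_module[OF torsion_part_submodule[OF assms] assms(1)]
  by (simp add: torsion_part_def)

text \<open>An injective linear map both preserves and reflects annihilation by \<pi>^k, so the
  given isomorphism restricts to the torsion parts.\<close>

lemma mod_iso_torsion_part:
  assumes "module A M" "module A N" "\<pi> \<in> carrier A" "mod_iso A M N"
  shows "mod_iso A (torsion_part A \<pi> M) (torsion_part A \<pi> N)"
proof -
  interpret M: module A M by fact
  interpret N: module A N by fact
  obtain h where h: "h \<in> mod_hom A M N" "bij_betw h (carrier M) (carrier N)"
    using assms(4) by (auto simp: mod_iso_def)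
  have pw: "\<pi> [^]\<^bsub>A\<^esub> k \<in> carrier A" for k :: nat using assms(3) by simp
  have inj: "inj_on h (carrier M)" and im: "h ` carrier M = carrier N"
    using h(2) by (auto simp: bij_betw_def)
  have iff: "(\<pi> [^]\<^bsub>A\<^esub> k) \<odot>\<^bsub>N\<^esub> h x = \<zero>\<^bsub>N\<^esub> \<longleftrightarrow> (\<pi> [^]\<^bsub>A\<^esub> k) \<odot>\<^bsub>M\<^esub> x = \<zero>\<^bsub>M\<^esub>"
    if "x \<in> carrier M" for x and k :: nat
  proof -
    have "(\<pi> [^]\<^bsub>A\<^esub> k) \<odot>\<^bsub>N\<^esub> h x = h ((\<pi> [^]\<^bsub>A\<^esub> k) \<odot>\<^bsub>M\<^esub> x)"
      using h(1) pw that by (auto simp: mod_hom_def)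
    then show ?thesis
      using mod_hom_zero[OF assms(1,2) h(1)] inj_onD[OF inj] that pw
      by (metis M.smult_closed M.zero_closed)
  qed
  have "h \<in> mod_hom A (torsion_part A \<pi> M) (torsion_part A \<pi> N)"
    using h(1) iff by (auto simp: mod_hom_def torsion_part_def Pi_iff)
  moreover have "bij_betw h (carrier (torsion_part A \<pi> M)) (carrier (torsion_part A \<pi> N))"
    unfolding bij_betw_def torsion_part_def
    using inj iff unfolding im[symmetric] by (auto simp: inj_on_def intro!: imageI)
  ultimately show ?thesis by (auto simp: mod_iso_def)
qed

section \<open>Direct sums and the regular module\<close>

lemma direct_sum_module:
  assumes "cring A" "\<And>i. i \<in> I \<Longrightarrow> module A (M i)"
  shows "module A (direct_sum I M)"
proof (rule moduleI)
  have ab: "abelian_group (M i)" if "i \<in> I" for i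
    using assms(2)[OF that] by (simp add: module_def)
  \<comment> \<open>The support of a sum lies in the union of the two supports.\<close>
  have fin_add: "finite {i \<in> I. x i \<oplus>\<^bsub>M i\<^esub> y i \<noteq> \<zero>\<^bsub>M i\<^esub>}"
    if "x \<in> carrier (direct_sum I M)" "y \<in> carrier (direct_sum I M)" for x y
  proof (rule finite_subset)
    show "{i \<in> I. x i \<oplus>\<^bsub>M i\<^esub> y i \<noteq> \<zero>\<^bsub>M i\<^esub>} \<subseteq> {i \<in> I. x i \<noteq> \<zero>\<^bsub>M i\<^esub>} \<union> {i \<in> I. y i \<noteq> \<zero>\<^bsub>M i\<^esub>}"
      using abelian_monoid.l_zero[OF abelian_group.axioms(1)[OF ab]]
        abelian_monoid.zero_closed[OF abelian_group.axioms(1)[OF ab]] by fastforce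
    show "finite \<dots>" using that by (auto simp: direct_sum_def)
  qed
  show smult: "a \<odot>\<^bsub>direct_sum I M\<^esub> x \<in> carrier (direct_sum I M)"
    if "a \<in> carrier A" "x \<in> carrier (direct_sum I M)" for a x
  proof -
    have "finite {i \<in> I. a \<odot>\<^bsub>M i\<^esub> x i \<noteq> \<zero>\<^bsub>M i\<^esub>}"
    proof (rule finite_subset)
      show "{i \<in> I. a \<odot>\<^bsub>M i\<^esub> x i \<noteq> \<zero>\<^bsub>M i\<^esub>} \<subseteq> {i \<in> I. x i \<noteq> \<zero>\<^bsub>M i\<^esub>}"
        using module.smult_r_null[OF assms(2) that(1)] by fastforce
      show "finite \<dots>" using that by (auto simp: direct_sum_def)
    qed
    moreover have "a \<odot>\<^bsub>M i\<^esub> x i \<in> carrier (M i)" if "i \<in> I" for i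
      using module.smult_closed[OF assms(2)] that \<open>a \<in> carrier A\<close> \<open>x \<in> carrier (direct_sum I M)\<close>
      by (auto simp: direct_sum_def)
    ultimately show ?thesis
      by (auto simp: direct_sum_def PiE_iff cong: conj_cong)
  qed
  show "abelian_group (direct_sum I M)"
  proof (rule abelian_groupI, goal_cases)
    case (1 x y)
    then show ?case
      using fin_add[OF 1] ab
      by (auto simp: direct_sum_def PiE_iff abelian_monoid.a_closed abelian_group_def conj_commute cong: conj_cong)
  next
    case 2
    then show ?case using ab by (auto simp: direct_sum_def abelian_monoid.zero_closed abelian_group_def cong: conj_cong)
  next
    case (3 x y z)
    then show ?case using ab
      by (auto simp: direct_sum_def PiE_iff abelian_monoid.a_assoc abelian_group_def intro!: restrict_ext)
  next
    case (4 x y)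
    then show ?case using ab
      by (auto simp: direct_sum_def PiE_iff abelian_monoid.a_comm abelian_group_def intro!: restrict_ext)
  next
    case (5 x)
    then show ?case using ab
      by (auto simp: direct_sum_def PiE_iff abelian_monoid.l_zero abelian_group_def extensional_def)
  next
    \<comment> \<open>The additive inverse is taken to be the multiple by -1, so that its finite
      support comes from the closure under scalars already shown.\<close>
    case (6 x)
    have "(\<ominus>\<^bsub>A\<^esub> \<one>\<^bsub>A\<^esub>) \<odot>\<^bsub>M i\<^esub> x i \<oplus>\<^bsub>M i\<^esub> x i = \<zero>\<^bsub>M i\<^esub>" if "i \<in> I" for i
    proof -
      interpret Mi: module A "M i" using assms(2) that .
      show ?thesis using 6 that by (simp add: direct_sum_def PiE_iff Mi.smult_l_minus Mi.l_neg)
    qed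
    then have "((\<ominus>\<^bsub>A\<^esub> \<one>\<^bsub>A\<^esub>) \<odot>\<^bsub>direct_sum I M\<^esub> x) \<oplus>\<^bsub>direct_sum I M\<^esub> x = \<zero>\<^bsub>direct_sum I M\<^esub>"
      by (auto simp: direct_sum_def intro!: restrict_ext)
    then show ?case
      using smult[OF _ 6] assms(1) by (meson cring.cring_simprules(3,6))
  qed
qed (use assms in \<open>auto simp: direct_sum_def PiE_iff extensional_def module.smult_l_distr
      module.smult_r_distr[OF assms(2)] module.smult_assoc1 module.smult_one intro!: restrict_ext\<close>)

lemma direct_sum2_module:
  assumes "module A M" "module A N"
  shows "module A (direct_sum2 M N)"
proof -
  interpret M: module A M by fact
  interpret N: module A N by fact
  show ?thesis
  proof (rule moduleI)
    show "cring A" by (rule M.R.is_cring)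
    show "abelian_group (direct_sum2 M N)"
    proof (rule abelian_groupI, goal_cases)
      case (6 x)
      then show ?case
        by (intro bexI[of _ "(\<ominus>\<^bsub>M\<^esub> fst x, \<ominus>\<^bsub>N\<^esub> snd x)"])
          (auto simp: direct_sum2_def M.l_neg N.l_neg)
    qed (auto simp: direct_sum2_def M.a_assoc N.a_assoc intro: M.a_comm N.a_comm)
  qed (auto simp: direct_sum2_def M.smult_l_distr M.smult_r_distr M.smult_assoc1
      N.smult_l_distr N.smult_r_distr N.smult_assoc1)
qed

lemma regular_module_module:
  assumes "cring A"
  shows "module A (regular_module A)"
proof -
  interpret cring A by fact
  show ?thesis
  proof (rule moduleI)
    show "abelian_group (regular_module A)"
    proof (rule abelian_groupI, goal_cases)
      case (6 x)
      then show ?case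
        by (intro bexI[of _ "\<ominus>\<^bsub>A\<^esub> x"]) (auto simp: regular_module_def l_neg)
    qed (auto simp: regular_module_def a_assoc intro: a_comm)
  qed (auto simp: regular_module_def l_distr r_distr m_assoc is_cring)
qed

section \<open>Quotient modules and subquotients\<close>

lemma a_r_coset_carrier_update [simp]: "B +>\<^bsub>M\<lparr>carrier := Z\<rparr>\<^esub> x = B +>\<^bsub>M\<^esub> x"
  by (simp add: a_r_coset_def r_coset_def)

context
  fixes A :: "('a, 'k) ring_scheme" and M :: "('a, 'b, 'm) module_scheme" and B :: "'b set"
  assumes module: "module A M" and sub: "submodule B A M"
begin

interpretation M: module A M by (rule module)

interpretation B: abelian_subgroup B M
  by (rule abelian_subgroupI3[OF additive_subgroup.intro])
    (use sub in \<open>simp_all add: submodule_def M.abelian_group_axioms\<close>)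

text \<open>The product is defined as a union over all representatives y of the coset. Since B is
  closed under scalars, a y and a x differ by an element of B, so all sets in this union
  coincide.\<close>

lemma quot_module_smult:
  assumes a: "a \<in> carrier A" and x: "x \<in> carrier M"
  shows "a \<odot>\<^bsub>quot_module M B\<^esub> (B +>\<^bsub>M\<^esub> x) = B +>\<^bsub>M\<^esub> (a \<odot>\<^bsub>M\<^esub> x)"
proof -
  have "B +>\<^bsub>M\<^esub> (a \<odot>\<^bsub>M\<^esub> y) = B +>\<^bsub>M\<^esub> (a \<odot>\<^bsub>M\<^esub> x)" if "y \<in> B +>\<^bsub>M\<^esub> x" for y
  proof -
    obtain b where b: "b \<in> B" "y = b \<oplus>\<^bsub>M\<^esub> x" using \<open>y \<in> B +>\<^bsub>M\<^esub> x\<close>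
      by (auto simp: a_r_coset_def r_coset_def)
    have "a \<odot>\<^bsub>M\<^esub> y = a \<odot>\<^bsub>M\<^esub> b \<oplus>\<^bsub>M\<^esub> a \<odot>\<^bsub>M\<^esub> x"
      using b a x by (simp add: M.smult_r_distr)
    moreover have "a \<odot>\<^bsub>M\<^esub> b \<in> B" using sub a b(1) by (simp add: submodule.smult_closed)
    ultimately have "a \<odot>\<^bsub>M\<^esub> y \<in> B +>\<^bsub>M\<^esub> (a \<odot>\<^bsub>M\<^esub> x)"
      by (auto simp: a_r_coset_def r_coset_def)
    then show ?thesis
      using B.a_repr_independence' a x by (metis M.smult_closed)
  qed
  then have "(\<Union>y\<in>B +>\<^bsub>M\<^esub> x. B +>\<^bsub>M\<^esub> (a \<odot>\<^bsub>M\<^esub> y)) = (\<Union>y\<in>B +>\<^bsub>M\<^esub> x. B +>\<^bsub>M\<^esub> (a \<odot>\<^bsub>M\<^esub> x))"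
    by (intro SUP_cong refl)
  also have "\<dots> = B +>\<^bsub>M\<^esub> (a \<odot>\<^bsub>M\<^esub> x)"
    using B.a_rcos_self[OF x] by blast
  finally show ?thesis by (simp only: quot_module_def module.simps)
qed

lemma quot_module_add:
  assumes "x \<in> carrier M" "y \<in> carrier M"
  shows "(B +>\<^bsub>M\<^esub> x) \<oplus>\<^bsub>quot_module M B\<^esub> (B +>\<^bsub>M\<^esub> y) = B +>\<^bsub>M\<^esub> (x \<oplus>\<^bsub>M\<^esub> y)"
  using assms by (simp add: quot_module_def B.a_rcos_sum)

lemma coset_eq_iff:
  assumes "x \<in> carrier M" "y \<in> carrier M"
  shows "B +>\<^bsub>M\<^esub> x = B +>\<^bsub>M\<^esub> y \<longleftrightarrow> x \<ominus>\<^bsub>M\<^esub> y \<in> B"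
proof -
  have "B +>\<^bsub>M\<^esub> x = B +>\<^bsub>M\<^esub> y \<longleftrightarrow> x \<in> B +>\<^bsub>M\<^esub> y"
    using B.a_rcos_self[OF assms(1)] B.a_repr_independence'[OF _ assms(2)] by metis
  then show ?thesis using B.a_rcos_module[OF assms(2,1)] by (simp add: a_minus_def)
qed

lemma carrier_quot_module: "carrier (quot_module M B) = (\<lambda>x. B +>\<^bsub>M\<^esub> x) ` carrier M"
  by (auto simp: quot_module_def A_RCOSETS_def RCOSETS_def a_r_coset_def)

lemma zero_quot_module: "\<zero>\<^bsub>quot_module M B\<^esub> = B +>\<^bsub>M\<^esub> \<zero>\<^bsub>M\<^esub>"
  using B.a_subset by (simp add: quot_module_def)

lemma quot_module_module: "module A (quot_module M B)"
proof (rule moduleI)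
  show "cring A" by (rule M.R.is_cring)
  show "abelian_group (quot_module M B)"
  proof (rule abelian_groupI, goal_cases)
    case (4 X Y)
    then show ?case by (auto simp: carrier_quot_module quot_module_add M.a_comm)
  next
    case (6 Y)
    then have "Y \<in> (\<lambda>x. B +>\<^bsub>M\<^esub> x) ` carrier M" by (simp only: carrier_quot_module)
    then show ?case
      by (rule imageE, intro bexI[of _ "B +>\<^bsub>M\<^esub> (\<ominus>\<^bsub>M\<^esub> _)"])
        (auto simp: carrier_quot_module quot_module_add M.l_neg zero_quot_module)
  qed (auto simp: carrier_quot_module quot_module_add M.a_assoc zero_quot_module)
qed (auto simp: carrier_quot_module quot_module_smult quot_module_add M.smult_l_distr
      M.smult_r_distr M.smult_assoc1)

end

text \<open>This is the image of Z in M/B, a copy of Z/(Z \<inter> B). It is used with B the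
  coboundaries and Z the homogeneous cocycles, both inside the module of all cochains.\<close>

lemma submodule_quot_module:
  assumes "module A M" "submodule B A M" "submodule Z A M"
  shows "module A ((quot_module M B)\<lparr>carrier := (\<lambda>x. B +>\<^bsub>M\<^esub> x) ` Z\<rparr>)"
proof -
  interpret M: module A M by fact
  interpret Q: module A "quot_module M B" by (rule quot_module_module[OF assms(1,2)])
  note Z = M.submoduleE[OF assms(3)]
  have sm: "a \<odot>\<^bsub>quot_module M B\<^esub> Y \<in> (\<lambda>x. B +>\<^bsub>M\<^esub> x) ` Z"
    if "a \<in> carrier A" "Y \<in> (\<lambda>x. B +>\<^bsub>M\<^esub> x) ` Z" for a Y
    using that Z(1,4) by (auto simp: quot_module_smult[OF assms(1,2)] subset_iff)
  have "submodule ((\<lambda>x. B +>\<^bsub>M\<^esub> x) ` Z) A (quot_module M B)"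
  proof (rule Q.submoduleI, goal_cases)
    case 1
    then show ?case using Z(1) by (auto simp: carrier_quot_module[OF assms(1,2)])
  next
    case 2
    have "\<zero>\<^bsub>M\<^esub> \<in> Z" using subgroup.one_closed[OF submodule.axioms(1)[OF assms(3)]] by simp
    then show ?case by (simp add: zero_quot_module[OF assms(1,2)])
  next
    case (3 a)
    then have "a \<in> carrier (quot_module M B)" using Z(1) by (auto simp: carrier_quot_module[OF assms(1,2)])
    \<comment> \<open>Negation is multiplication by -1, which reduces closure under it to closure
      under scalars.\<close>
    then have "\<ominus>\<^bsub>quot_module M B\<^esub> a = (\<ominus>\<^bsub>A\<^esub> \<one>\<^bsub>A\<^esub>) \<odot>\<^bsub>quot_module M B\<^esub> a"
      by (simp add: Q.smult_l_minus)
    then show ?case using 3 sm by simp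
  next
    case (4 a b)
    then obtain x y where xy: "x \<in> Z" "y \<in> Z" "a = B +>\<^bsub>M\<^esub> x" "b = B +>\<^bsub>M\<^esub> y" by auto
    then have "x \<in> carrier M" "y \<in> carrier M" using Z(1) by auto
    then have "a \<oplus>\<^bsub>quot_module M B\<^esub> b = B +>\<^bsub>M\<^esub> (x \<oplus>\<^bsub>M\<^esub> y)"
      using xy by (simp add: quot_module_add[OF assms(1,2)])
    then show ?case using Z(5) xy by auto
  next
    case (5 a x)
    then show ?case by (rule sm)
  qed
  then show ?thesis by (rule submodule.submodule_is_module) (rule quot_module_module[OF assms(1,2)])
qed

lemma mod_hom_minus:
  assumes "module A M" "module A N" "h \<in> mod_hom A M N" "x \<in> carrier M" "y \<in> carrier M"
  shows "h (x \<ominus>\<^bsub>M\<^esub> y) = h x \<ominus>\<^bsub>N\<^esub> h y"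
proof -
  interpret M: module A M by fact
  interpret N: module A N by fact
  have hc: "h x \<in> carrier N" "h y \<in> carrier N" using assms by (auto simp: mod_hom_def)
  have 1: "\<ominus>\<^bsub>A\<^esub> \<one>\<^bsub>A\<^esub> \<in> carrier A" by simp
  have "x \<ominus>\<^bsub>M\<^esub> y = x \<oplus>\<^bsub>M\<^esub> (\<ominus>\<^bsub>A\<^esub> \<one>\<^bsub>A\<^esub>) \<odot>\<^bsub>M\<^esub> y"
    using assms by (simp add: M.smult_l_minus M.minus_eq)
  moreover have "h x \<ominus>\<^bsub>N\<^esub> h y = h x \<oplus>\<^bsub>N\<^esub> (\<ominus>\<^bsub>A\<^esub> \<one>\<^bsub>A\<^esub>) \<odot>\<^bsub>N\<^esub> h y"
    using hc by (simp add: N.smult_l_minus N.minus_eq)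
  moreover have "(\<ominus>\<^bsub>A\<^esub> \<one>\<^bsub>A\<^esub>) \<odot>\<^bsub>M\<^esub> y \<in> carrier M" using assms 1 by blast
  ultimately show ?thesis using assms(3-5) 1 by (simp add: mod_hom_def)
qed

text \<open>The two maps are inverse bijections between Z and W that match Z \<inter> B with W
  \<inter> B. Preservation of B by \<phi> makes the induced map on cosets well defined, preservation
  by \<psi> makes it injective.\<close>

lemma mod_iso_subquotients:
  assumes M: "module A M" and B: "submodule B A M" and Z: "submodule Z A M" and W: "submodule W A M"
    and \<phi>: "\<phi> \<in> mod_hom A M M" and \<psi>: "\<psi> \<in> mod_hom A M M"
    and ZW: "\<And>z. z \<in> Z \<Longrightarrow> \<phi> z \<in> W" "\<And>w. w \<in> W \<Longrightarrow> \<psi> w \<in> Z"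
    and inv: "\<And>z. z \<in> Z \<Longrightarrow> \<psi> (\<phi> z) = z" "\<And>w. w \<in> W \<Longrightarrow> \<phi> (\<psi> w) = w"
    and bd: "\<And>z. z \<in> Z \<Longrightarrow> z \<in> B \<Longrightarrow> \<phi> z \<in> B" "\<And>w. w \<in> W \<Longrightarrow> w \<in> B \<Longrightarrow> \<psi> w \<in> B"
  shows "mod_iso A ((quot_module M B)\<lparr>carrier := (\<lambda>x. B +>\<^bsub>M\<^esub> x) ` Z\<rparr>)
    ((quot_module M B)\<lparr>carrier := (\<lambda>x. B +>\<^bsub>M\<^esub> x) ` W\<rparr>)"
proof -
  interpret M: module A M by fact
  let ?c = "\<lambda>x. B +>\<^bsub>M\<^esub> x"
  note Zs = M.submoduleE[OF Z] and Ws = M.submoduleE[OF W]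
  have Zm: "x \<ominus>\<^bsub>M\<^esub> y \<in> Z" if "x \<in> Z" "y \<in> Z" for x y using that Zs by (simp add: M.minus_eq)
  have Wm: "x \<ominus>\<^bsub>M\<^esub> y \<in> W" if "x \<in> W" "y \<in> W" for x y using that Ws by (simp add: M.minus_eq)
  have iff: "?c (\<phi> x) = ?c (\<phi> y) \<longleftrightarrow> ?c x = ?c y" if xy: "x \<in> Z" "y \<in> Z" for x y
  proof -
    have car: "x \<in> carrier M" "y \<in> carrier M" "\<phi> x \<in> carrier M" "\<phi> y \<in> carrier M"
      using xy Zs(1) Ws(1) ZW by auto
    have eq: "\<phi> (x \<ominus>\<^bsub>M\<^esub> y) = \<phi> x \<ominus>\<^bsub>M\<^esub> \<phi> y"
      using mod_hom_minus[OF M M \<phi>] car by simp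
    have "x \<ominus>\<^bsub>M\<^esub> y \<in> B \<longleftrightarrow> \<phi> x \<ominus>\<^bsub>M\<^esub> \<phi> y \<in> B"
      using bd(1)[of "x \<ominus>\<^bsub>M\<^esub> y"] bd(2)[of "\<phi> (x \<ominus>\<^bsub>M\<^esub> y)"] Zm[OF xy] ZW(1) inv(1) eq by metis
    then show ?thesis using car by (simp add: coset_eq_iff[OF M B])
  qed
  \<comment> \<open>A representative in Z is chosen; by \<open>iff\<close> the resulting coset does
    not depend on the choice.\<close>
  define h where "h Y = ?c (\<phi> (SOME z. z \<in> Z \<and> Y = ?c z))" for Y
  have h: "h (?c z) = ?c (\<phi> z)" if "z \<in> Z" for z
  proof -
    have "\<exists>z'. z' \<in> Z \<and> ?c z = ?c z'" using that by blast
    from someI_ex[OF this] show ?thesis unfolding h_def using iff that by metis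
  qed
  have "h \<in> mod_hom A ((quot_module M B)\<lparr>carrier := ?c ` Z\<rparr>) ((quot_module M B)\<lparr>carrier := ?c ` W\<rparr>)"
    unfolding mod_hom_def
  proof (intro CollectI conjI ballI Pi_I, goal_cases)
    case (1 x)
    then show ?case using h ZW by auto
  next
    case (2 V Y)
    then obtain x y where xy: "x \<in> Z" "y \<in> Z" "V = ?c x" "Y = ?c y" by auto
    then have car: "x \<in> carrier M" "y \<in> carrier M" "\<phi> x \<in> carrier M" "\<phi> y \<in> carrier M"
      using Zs(1) Ws(1) ZW by auto
    have "\<phi> (x \<oplus>\<^bsub>M\<^esub> y) = \<phi> x \<oplus>\<^bsub>M\<^esub> \<phi> y" using \<phi> car by (simp add: mod_hom_def)
    then show ?case
      using car xy h[OF Zs(5)[OF xy(1,2)]] h[OF xy(1)] h[OF xy(2)]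
      by (simp add: quot_module_add[OF M B])
  next
    case (3 a Y)
    then obtain x where x: "x \<in> Z" "Y = ?c x" by auto
    then have car: "x \<in> carrier M" "\<phi> x \<in> carrier M"
      using Zs(1) Ws(1) ZW by auto
    have "\<phi> (a \<odot>\<^bsub>M\<^esub> x) = a \<odot>\<^bsub>M\<^esub> \<phi> x" using \<phi> car 3 by (simp add: mod_hom_def)
    then show ?case
      using car x 3 h[OF Zs(4)[OF 3(1) x(1)]] h[OF x(1)]
      by (simp add: quot_module_smult[OF M B])
  qed
  moreover have "bij_betw h (?c ` Z) (?c ` W)"
    unfolding bij_betw_def
  proof
    show "inj_on h (?c ` Z)" by (auto simp: inj_on_def h iff)
    show "h ` ?c ` Z = ?c ` W"
    proof (intro equalityI subsetI)
      fix Y assume "Y \<in> ?c ` W"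
      then obtain w where "w \<in> W" "Y = ?c w" by auto
      then have "Y = h (?c (\<psi> w))" using ZW(2) h inv(2) by simp
      then show "Y \<in> h ` ?c ` Z" using ZW(2) \<open>w \<in> W\<close> by blast
    qed (use h ZW in auto)
  qed
  ultimately show ?thesis by (auto simp: mod_iso_def)
qed

text \<open>The divisible part of \<open>P' \<oplus> Q'\<close> is \<open>P'\<close>, whose preimage meets \<open>Q\<close> only in multiples
  of \<open>a\<close>, that is, in zero.\<close>

lemma inj_hom_of_direct_sum2_iso:
  assumes P: "module A P" and Q: "module A Q" and P': "module A P'" and Q': "module A Q'"
    and a: "a \<in> carrier A"
    and ann: "\<And>q. q \<in> carrier Q \<Longrightarrow> a \<odot>\<^bsub>Q\<^esub> q = \<zero>\<^bsub>Q\<^esub>"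
    and div: "\<And>e. e \<in> carrier P' \<Longrightarrow> \<exists>f\<in>carrier P'. e = a \<odot>\<^bsub>P'\<^esub> f"
    and iso: "mod_iso A (direct_sum2 P Q) (direct_sum2 P' Q')"
  shows "\<exists>\<psi>\<in>mod_hom A Q Q'. inj_on \<psi> (carrier Q)"
proof -
  interpret P: module A P by fact
  interpret Q: module A Q by fact
  interpret P': module A P' by fact
  interpret Q': module A Q' by fact
  let ?S = "direct_sum2 P Q" and ?S' = "direct_sum2 P' Q'"
  interpret S: module A ?S by (rule direct_sum2_module[OF P Q])
  interpret S': module A ?S' by (rule direct_sum2_module[OF P' Q'])
  obtain h where h: "h \<in> mod_hom A ?S ?S'" "bij_betw h (carrier ?S) (carrier ?S')"
    using iso by (auto simp: mod_iso_def)
  have inj: "inj_on h (carrier ?S)" and im: "h ` carrier ?S = carrier ?S'"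
    using h(2) by (auto simp: bij_betw_def)
  let ?i = "\<lambda>q. (\<zero>\<^bsub>P\<^esub>, q)"
  have i: "?i q \<in> carrier ?S" if "q \<in> carrier Q" for q using that by (simp add: direct_sum2_def)
  have hc: "h x \<in> carrier ?S'" if "x \<in> carrier ?S" for x using h(1) that by (auto simp: mod_hom_def)
  have snd: "snd x \<in> carrier Q" if "x \<in> carrier ?S" for x using that by (auto simp: direct_sum2_def)
  \<comment> \<open>The composite of the inclusion of Q, the isomorphism \<open>h\<close> and the
    projection onto Q'.\<close>
  define \<psi> where "\<psi> q = snd (h (?i q))" for q
  have "\<psi> \<in> mod_hom A Q Q'"
    unfolding mod_hom_def
  proof (intro CollectI conjI ballI Pi_I, goal_cases)
    case (1 x)
    show ?case using hc[OF i[OF 1]] by (auto simp: \<psi>_def direct_sum2_def)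
  next
    case (2 x y)
    have "?i (x \<oplus>\<^bsub>Q\<^esub> y) = ?i x \<oplus>\<^bsub>?S\<^esub> ?i y" by (simp add: direct_sum2_def)
    then have "h (?i (x \<oplus>\<^bsub>Q\<^esub> y)) = h (?i x) \<oplus>\<^bsub>?S'\<^esub> h (?i y)"
      using h(1) i 2 by (auto simp: mod_hom_def)
    then show ?case by (simp add: \<psi>_def direct_sum2_def)
  next
    case (3 b x)
    have "?i (b \<odot>\<^bsub>Q\<^esub> x) = b \<odot>\<^bsub>?S\<^esub> ?i x" using 3 by (simp add: direct_sum2_def)
    then have "h (?i (b \<odot>\<^bsub>Q\<^esub> x)) = b \<odot>\<^bsub>?S'\<^esub> h (?i x)"
      using h(1) i 3 by (auto simp: mod_hom_def)
    then show ?case by (simp add: \<psi>_def direct_sum2_def)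
  qed
  moreover have "inj_on \<psi> (carrier Q)"
  proof (rule inj_onI)
    fix q q' assume q: "q \<in> carrier Q" "q' \<in> carrier Q" "\<psi> q = \<psi> q'"
    \<comment> \<open>As the second coordinates agree, h (0, q) and h (0, q') differ by (e, 0).
      Writing e = a f and (f, 0) = h r, injectivity gives (0, q) = (0, q') + a r, and a kills the
      Q-coordinate of r.\<close>
    define e where "e = fst (h (?i q)) \<ominus>\<^bsub>P'\<^esub> fst (h (?i q'))"
    have car: "h (?i q) \<in> carrier ?S'" "h (?i q') \<in> carrier ?S'" using hc i q by auto
    then have e: "e \<in> carrier P'" by (auto simp: e_def direct_sum2_def)
    then obtain f where f: "f \<in> carrier P'" "e = a \<odot>\<^bsub>P'\<^esub> f" using div by blast
    then have "(f, \<zero>\<^bsub>Q'\<^esub>) \<in> carrier ?S'" by (simp add: direct_sum2_def)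
    then obtain r where r: "r \<in> carrier ?S" "h r = (f, \<zero>\<^bsub>Q'\<^esub>)" using im by (metis imageE)
    have "h (?i q' \<oplus>\<^bsub>?S\<^esub> a \<odot>\<^bsub>?S\<^esub> r) = h (?i q') \<oplus>\<^bsub>?S'\<^esub> a \<odot>\<^bsub>?S'\<^esub> h r"
      using h(1) i q(2) a r(1) S.smult_closed[OF a r(1)] by (auto simp: mod_hom_def)
    also have "\<dots> = (fst (h (?i q')) \<oplus>\<^bsub>P'\<^esub> e, snd (h (?i q')) \<oplus>\<^bsub>Q'\<^esub> \<zero>\<^bsub>Q'\<^esub>)"
      using f a r by (simp add: direct_sum2_def)
    also have "\<dots> = h (?i q)"
      using car q(3) by (auto simp: e_def \<psi>_def direct_sum2_def P'.minus_eq P'.a_lcomm P'.r_neg)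
    finally have "?i q' \<oplus>\<^bsub>?S\<^esub> a \<odot>\<^bsub>?S\<^esub> r = ?i q"
      using inj i q r a by (meson S.a_closed S.smult_closed inj_onD)
    then have "q' \<oplus>\<^bsub>Q\<^esub> a \<odot>\<^bsub>Q\<^esub> snd r = q" by (auto simp: direct_sum2_def)
    then show "q = q'" using ann[OF snd[OF r(1)]] q by simp
  qed
  ultimately show ?thesis by blast
qed

text \<open>A linear map sends b x to b \<psi>(x), so an injection of Q into Q' restricts to one of
  bQ into bQ'. With b = \<pi>^k this bounds the invariants that determine the
  multiplicities.\<close>

lemma card_smult_image_le:
  assumes "\<psi> \<in> mod_hom A Q Q'" "inj_on \<psi> (carrier Q)" "finite (carrier Q')"
    and "module A Q" "module A Q'" "b \<in> carrier A"
  shows "card ((\<lambda>x. b \<odot>\<^bsub>Q\<^esub> x) ` carrier Q) \<le> card ((\<lambda>x. b \<odot>\<^bsub>Q'\<^esub> x) ` carrier Q')"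
proof (rule card_inj_on_le)
  show "inj_on \<psi> ((\<lambda>x. b \<odot>\<^bsub>Q\<^esub> x) ` carrier Q)"
    using assms by (intro inj_on_subset[OF assms(2)]) (auto intro: module.smult_closed)
  show "\<psi> ` (\<lambda>x. b \<odot>\<^bsub>Q\<^esub> x) ` carrier Q \<subseteq> (\<lambda>x. b \<odot>\<^bsub>Q'\<^esub> x) ` carrier Q'"
    using assms(1,6) by (auto simp: mod_hom_def Pi_iff)
qed (use assms in auto)

section \<open>Uniqueness of the torsion decomposition\<close>

abbreviation (input) type_ring :: "'a::idom ring" where
  "type_ring \<equiv> ring_of_type_algebra"

lemma type_ring_simps [simp]:
  "carrier (type_ring :: 'a::idom ring) = UNIV"
  "monoid.mult (type_ring :: 'a::idom ring) = (*)"
  "add (type_ring :: 'a::idom ring) = (+)"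
  "one (type_ring :: 'a::idom ring) = 1"
  "ring.zero (type_ring :: 'a::idom ring) = 0"
  by (simp_all add: ring_of_type_algebra_def fun_eq_iff)

lemma type_ring_pow [simp]: "a [^]\<^bsub>(type_ring :: 'a::idom ring)\<^esub> (k::nat) = a ^ k"
proof -
  interpret cring "type_ring :: 'a ring" by (rule cring_from_type_algebra)
  show ?thesis by (induction k) (simp_all add: mult.commute)
qed

lemma PIdl_type_ring: "PIdl\<^bsub>(type_ring :: 'a::idom ring)\<^esub> a = {x. a dvd x}"
  by (auto simp: cgenideal_def dvd_def mult.commute)

text \<open>The principal ideal in divisibility form serves twice: as the ideal from which maps are
  extended in the proof of divisibility, and as the modulus of \<open>cyclic_quot\<close>.\<close>

lemma dvd_submodule:
  "submodule {c. a dvd c} (type_ring :: 'a::idom ring) (regular_module type_ring)"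
proof -
  let ?A = "type_ring :: 'a ring"
  interpret R: module ?A "regular_module ?A" by (rule regular_module_module[OF cring_from_type_algebra])
  show ?thesis
  proof (rule R.submoduleI, goal_cases)
    case (3 c)
    have "\<ominus>\<^bsub>regular_module ?A\<^esub> c = - c"
      by (rule R.M.minus_equality) (auto simp: regular_module_def)
    then show ?case using 3 by simp
  qed (auto simp: regular_module_def)
qed

text \<open>The map sending a b to b x on the ideal generated by a extends to the whole ring; the
  value y of the extension at 1 satisfies a y = x.\<close>

lemma injective_module_divisible:
  fixes E :: "('a::idom, 'e) module"
  assumes E: "injective_module type_ring E" and "a \<noteq> 0" and x: "x \<in> carrier E"
  shows "\<exists>y\<in>carrier E. x = a \<odot>\<^bsub>E\<^esub> y"
proof -
  let ?A = "type_ring :: 'a ring"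
  interpret E: module ?A E using E by (simp add: injective_module_def)
  let ?N = "{c. a dvd c}"
  note R = regular_module_module[OF E.R.is_cring]
  have N: "submodule ?N ?A (regular_module ?A)" by (rule dvd_submodule)
  \<comment> \<open>The quotient of c by a is unique because a is nonzero in a domain;
    \<open>h\<close> matters only on multiples of a.\<close>
  define h where "h c = (THE b. c = a * b) \<odot>\<^bsub>E\<^esub> x" for c
  have h: "h (a * b) = b \<odot>\<^bsub>E\<^esub> x" for b
    using \<open>a \<noteq> 0\<close> by (simp add: h_def)
  have smult: "(b + c) \<odot>\<^bsub>E\<^esub> x = b \<odot>\<^bsub>E\<^esub> x \<oplus>\<^bsub>E\<^esub> c \<odot>\<^bsub>E\<^esub> x"
    "(b * c) \<odot>\<^bsub>E\<^esub> x = b \<odot>\<^bsub>E\<^esub> (c \<odot>\<^bsub>E\<^esub> x)" "1 \<odot>\<^bsub>E\<^esub> x = x" "b \<odot>\<^bsub>E\<^esub> x \<in> carrier E" for b c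
    using E.smult_l_distr[OF _ _ x, of b c] E.smult_assoc1[OF _ _ x, of b c] E.smult_one[OF x]
      E.smult_closed[OF _ x, of b]
    by (simp_all only: type_ring_simps UNIV_I True_implies_equals)
  have hom: "h \<in> mod_hom ?A ((regular_module ?A)\<lparr>carrier := ?N\<rparr>) E"
    unfolding mod_hom_def
  proof (intro CollectI conjI ballI Pi_I, goal_cases)
    case (1 c)
    then obtain c' where c: "c = a * c'" by (auto simp: dvd_def)
    show ?case unfolding c h by (rule smult(4))
  next
    case (2 c d)
    then obtain c' d' where cd: "c = a * c'" "d = a * d'" by (auto simp: dvd_def)
    have "h (a * (c' + d')) = h (a * c') \<oplus>\<^bsub>E\<^esub> h (a * d')"
      unfolding h by (rule smult(1))
    then show ?case by (simp add: cd regular_module_def distrib_left)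
  next
    case (3 b c)
    then obtain c' where c: "c = a * c'" by (auto simp: dvd_def)
    have "h (a * (b * c')) = b \<odot>\<^bsub>E\<^esub> h (a * c')"
      unfolding h by (rule smult(2))
    then show ?case by (simp add: c regular_module_def mult.left_commute)
  qed
  then obtain g where g: "g \<in> mod_hom ?A (regular_module ?A) E" "\<forall>c\<in>?N. g c = h c"
    using E[unfolded injective_module_def, THEN conjunct2, rule_format, OF conjI[OF R N] hom]
    by (elim bexE)
  have "x = h (a * 1)" by (simp only: h smult)
  also have "\<dots> = g (a * 1)" using g by simp
  also have "\<dots> = a \<odot>\<^bsub>E\<^esub> g 1"
    using g(1) by (simp only: mod_hom_def regular_module_def mem_Collect_eq module.simps type_ring_simps ball_UNIV
        partial_object.simps monoid.simps ring.simps)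
  finally show ?thesis using g(1) by (auto simp: mod_hom_def regular_module_def)
qed

section \<open>Counting residue classes and multiples\<close>

lemma card_range_eq:
  assumes "\<And>x y. f x = f y \<longleftrightarrow> g x = g y"
  shows "card (range f) = card (range g)"
proof (rule bij_betw_same_card)
  \<comment> \<open>The chosen preimage of f x may differ from x, but lies in the same fibre of f
    and hence of g.\<close>
  have *: "g (inv_into UNIV f (f x)) = g x" for x
    using assms[of "inv_into UNIV f (f x)" x] by (simp add: f_inv_into_f)
  show "bij_betw (\<lambda>y. g (inv_into UNIV f y)) (range f) (range g)"
    unfolding bij_betw_def inj_on_def using assms by (auto simp: * image_image)
qed

text \<open>The coset x + aA, described by divisibility so that comparing cosets becomes a question
  of divisibility.\<close>

definition residue_class :: "'a::idom \<Rightarrow> 'a \<Rightarrow> 'a set" where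
  "residue_class a x = {y. a dvd y - x}"

lemma residue_class_eq_iff: "residue_class a x = residue_class a y \<longleftrightarrow> a dvd x - y"
proof
  assume "residue_class a x = residue_class a y"
  moreover have "x \<in> residue_class a x" by (simp add: residue_class_def)
  ultimately show "a dvd x - y" by (simp add: residue_class_def)
next
  assume *: "a dvd x - y"
  have "a dvd z - x \<longleftrightarrow> a dvd z - y" for z
    using dvd_add_left_iff[OF *, of "z - x"] by simp
  then show "residue_class a x = residue_class a y" by (simp add: residue_class_def)
qed

lemma coset_regular_module: "{z. a dvd z} +>\<^bsub>regular_module type_ring\<^esub> x = residue_class a x"
proof -
  have "\<exists>h. a dvd h \<and> y = h + x" if "a dvd y - x" for y
    using that by (intro exI[of _ "y - x"]) simp
  then show ?thesis by (auto simp: a_r_coset_def r_coset_def regular_module_def residue_class_def)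
qed

lemma cyclic_quot_eq: "cyclic_quot type_ring \<pi> j = quot_module (regular_module type_ring) {z. \<pi> ^ j dvd z}"
  by (simp add: cyclic_quot_def PIdl_type_ring)

lemma cyclic_quot_module: "module type_ring (cyclic_quot type_ring \<pi> j)"
  unfolding cyclic_quot_eq
  by (intro quot_module_module regular_module_module cring_from_type_algebra dvd_submodule)

lemma carrier_regular_module: "carrier (regular_module type_ring) = UNIV"
  by (simp add: regular_module_def)

lemma carrier_cyclic_quot: "carrier (cyclic_quot type_ring \<pi> j) = range (residue_class (\<pi> ^ j))"
  unfolding cyclic_quot_eq
  by (subst carrier_quot_module[OF regular_module_module[OF cring_from_type_algebra] dvd_submodule])
    (simp add: coset_regular_module carrier_regular_module)

lemma smult_cyclic_quot:
  "b \<odot>\<^bsub>cyclic_quot type_ring \<pi> j\<^esub> residue_class (\<pi> ^ j) x = residue_class (\<pi> ^ j) (b * x)"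
  unfolding cyclic_quot_eq
  using quot_module_smult[OF regular_module_module[OF cring_from_type_algebra] dvd_submodule[of "\<pi> ^ j"], of b x]
  by (simp add: coset_regular_module carrier_regular_module) (simp add: regular_module_def)

text \<open>Multiplication by \<pi>^k identifies \<pi>^k (A/\<pi>^j) with A/\<pi>^(j-k), because
  \<pi>^j divides \<pi>^k d exactly when \<pi>^(j-k) divides d. For k \<ge> j the truncated
  difference is 0 and both sides count one class.\<close>

lemma card_smult_cyclic_quot:
  assumes "\<pi> \<noteq> 0"
  shows "card ((\<lambda>Y. (\<pi> ^ k) \<odot>\<^bsub>cyclic_quot type_ring \<pi> j\<^esub> Y) ` carrier (cyclic_quot type_ring \<pi> j)) =
    card (range (residue_class (\<pi> ^ (j - k))))"
proof -
  have *: "\<pi> ^ j dvd \<pi> ^ k * d \<longleftrightarrow> \<pi> ^ (j - k) dvd d" for d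
  proof (cases "k \<le> j")
    case True
    then have "\<pi> ^ j = \<pi> ^ k * \<pi> ^ (j - k)" by (simp flip: power_add)
    then show ?thesis using assms by simp
  next
    case False
    then have "\<pi> ^ j dvd \<pi> ^ k" by (intro le_imp_power_dvd) simp
    then show ?thesis using False by simp
  qed
  have "(\<lambda>Y. (\<pi> ^ k) \<odot>\<^bsub>cyclic_quot type_ring \<pi> j\<^esub> Y) ` carrier (cyclic_quot type_ring \<pi> j) =
      range (\<lambda>x. residue_class (\<pi> ^ j) (\<pi> ^ k * x))"
    by (simp add: carrier_cyclic_quot image_image smult_cyclic_quot)
  then show ?thesis
    by (simp only:) (rule card_range_eq, simp add: residue_class_eq_iff * flip: right_diff_distrib)
qed

text \<open>Write x = \<rho>(x) + \<pi> d(x) with a fixed representative \<rho>(x) of the class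
  modulo \<pi>. The class of x modulo \<pi>^(m+1) then corresponds to the class of x modulo \<pi>
  together with that of d(x) modulo \<pi>^m.\<close>

lemma card_residue_classes_power:
  fixes \<pi> :: "'a::idom"
  assumes "\<pi> \<noteq> 0"
  shows "card (range (residue_class (\<pi> ^ m))) = card (range (residue_class \<pi>)) ^ m"
proof (induction m)
  case 0
  have "residue_class (\<pi> ^ 0) = (\<lambda>_. UNIV)" by (simp add: residue_class_def fun_eq_iff)
  then show ?case by simp
next
  case (Suc m)
  \<comment> \<open>The choice is made from the class and not from x, so congruent elements receive
    the same representative.\<close>
  define \<rho> where "\<rho> x = (SOME y. y \<in> residue_class \<pi> x)" for x
  have d\<rho>: "\<pi> dvd \<rho> x - x" for x
    unfolding \<rho>_def using someI[of "\<lambda>y. y \<in> residue_class \<pi> x" x] by (simp add: residue_class_def)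
  have dx: "\<pi> dvd x - \<rho> x" for x using d\<rho>[of x] dvd_minus_iff[of \<pi> "\<rho> x - x"] by simp
  define d where "d x = (SOME z. x - \<rho> x = \<pi> * z)" for x
  have d: "x - \<rho> x = \<pi> * d x" for x
    unfolding d_def by (rule someI_ex) (use dx[of x] in \<open>simp add: dvd_def\<close>)
  have \<rho>: "\<rho> x = \<rho> y" if "residue_class \<pi> x = residue_class \<pi> y" for x y
    using that by (simp add: \<rho>_def)
  let ?F = "\<lambda>x. (residue_class \<pi> x, residue_class (\<pi> ^ m) (d x))"
  have "residue_class (\<pi> ^ Suc m) x = residue_class (\<pi> ^ Suc m) y \<longleftrightarrow> ?F x = ?F y" for x y
  proof (cases "residue_class \<pi> x = residue_class \<pi> y")
    case True
    have "x - y = \<pi> * (d x - d y)"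
      unfolding right_diff_distrib d[symmetric] using \<rho>[OF True] by simp
    then show ?thesis using True assms by (simp add: residue_class_eq_iff)
  next
    case False
    moreover have "\<not> \<pi> ^ Suc m dvd x - y"
      using False dvd_trans[of \<pi> "\<pi> ^ Suc m" "x - y"] by (auto simp: residue_class_eq_iff)
    ultimately show ?thesis by (simp add: residue_class_eq_iff)
  qed
  then have "card (range (residue_class (\<pi> ^ Suc m))) = card (range ?F)"
    by (rule card_range_eq)
  also have "range ?F = range (residue_class \<pi>) \<times> range (residue_class (\<pi> ^ m))"
  proof (intro equalityI subsetI)
    fix p assume "p \<in> range (residue_class \<pi>) \<times> range (residue_class (\<pi> ^ m))"
    then obtain x z where p: "p = (residue_class \<pi> x, residue_class (\<pi> ^ m) z)" by auto
    \<comment> \<open>This element has the class of x, hence the same representative, and so its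
      quotient \<open>d\<close> is z: every pair of classes is attained.\<close>
    let ?y = "\<rho> x + \<pi> * z"
    have "?y - x = \<pi> * (z - d x)" using d[of x] by (simp add: algebra_simps)
    then have eq: "residue_class \<pi> ?y = residue_class \<pi> x" by (simp add: residue_class_eq_iff)
    have "d ?y = z" using d[of ?y] \<rho>[OF eq] assms by simp
    then have "p = ?F ?y" using eq p by simp
    then show "p \<in> range ?F" by blast
  qed auto
  finally show ?case using Suc by (simp add: card_cartesian_product)
qed

text \<open>Over a finite index set the support condition is vacuous, so preimages can be chosen in
  each coordinate independently.\<close>

lemma smult_image_direct_sum:
  assumes "finite I" "cring A" "\<And>i. i \<in> I \<Longrightarrow> module A (M i)" "b \<in> carrier A"
  shows "(\<lambda>x. b \<odot>\<^bsub>direct_sum I M\<^esub> x) ` carrier (direct_sum I M) =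
    (\<Pi>\<^sub>E i\<in>I. (\<lambda>x. b \<odot>\<^bsub>M i\<^esub> x) ` carrier (M i))"
proof (intro equalityI subsetI)
  fix y assume y: "y \<in> (\<Pi>\<^sub>E i\<in>I. (\<lambda>x. b \<odot>\<^bsub>M i\<^esub> x) ` carrier (M i))"
  then have "\<forall>i\<in>I. \<exists>x. x \<in> carrier (M i) \<and> y i = b \<odot>\<^bsub>M i\<^esub> x" by (auto simp: PiE_iff)
  then obtain x where x: "\<forall>i\<in>I. x i \<in> carrier (M i) \<and> y i = b \<odot>\<^bsub>M i\<^esub> x i" by (rule bchoice[THEN exE])
  have "y = b \<odot>\<^bsub>direct_sum I M\<^esub> restrict x I"
    using x y by (auto simp: direct_sum_def PiE_iff extensional_def)
  moreover have "restrict x I \<in> carrier (direct_sum I M)"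
    using x assms(1) by (auto simp: direct_sum_def)
  ultimately show "y \<in> (\<lambda>x. b \<odot>\<^bsub>direct_sum I M\<^esub> x) ` carrier (direct_sum I M)" by blast
qed (auto simp: direct_sum_def PiE_iff)

text \<open>Each summand A/\<pi>^j contributes a factor q^(j-k), where q is the number of classes
  modulo \<pi>; by truncated subtraction the factor is 1 when j \<le> k.\<close>

lemma card_smult_reduced_part:
  fixes \<alpha> :: "nat \<Rightarrow> nat" and s :: nat
  assumes "\<pi> \<noteq> 0"
  defines "Q \<equiv> direct_sum (SIGMA j:{1..s}. {..<\<alpha> j}) (\<lambda>(j, _). cyclic_quot type_ring \<pi> j)"
  shows "card ((\<lambda>x. (\<pi> ^ k) \<odot>\<^bsub>Q\<^esub> x) ` carrier Q) =
    card (range (residue_class \<pi>)) ^ (\<Sum>j=1..s. \<alpha> j * (j - k))"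
proof -
  let ?I = "SIGMA j:{1..s}. {..<\<alpha> j}" and ?M = "\<lambda>(j, _ :: nat). cyclic_quot type_ring \<pi> j"
  have m: "module type_ring (?M i)" for i by (auto simp: cyclic_quot_module split: prod.splits)
  have "(\<lambda>x. (\<pi> ^ k) \<odot>\<^bsub>Q\<^esub> x) ` carrier Q = (\<Pi>\<^sub>E i\<in>?I. (\<lambda>x. (\<pi> ^ k) \<odot>\<^bsub>?M i\<^esub> x) ` carrier (?M i))"
    unfolding Q_def by (rule smult_image_direct_sum[where A = type_ring]) (simp_all add: cring_from_type_algebra m)
  then have "card ((\<lambda>x. (\<pi> ^ k) \<odot>\<^bsub>Q\<^esub> x) ` carrier Q) =
      (\<Prod>i\<in>?I. card ((\<lambda>x. (\<pi> ^ k) \<odot>\<^bsub>?M i\<^esub> x) ` carrier (?M i)))"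
    by (simp add: card_PiE)
  also have "\<dots> = (\<Prod>(j, i)\<in>?I. card (range (residue_class \<pi>)) ^ (j - k))"
    by (rule prod.cong)
      (auto simp: card_smult_cyclic_quot[OF assms(1)] card_residue_classes_power[OF assms(1)])
  also have "\<dots> = (\<Prod>j=1..s. \<Prod>i<\<alpha> j. card (range (residue_class \<pi>)) ^ (j - k))"
    by (subst prod.Sigma) auto
  also have "\<dots> = card (range (residue_class \<pi>)) ^ (\<Sum>j=1..s. \<alpha> j * (j - k))"
    by (simp add: power_sum mult.commute flip: power_mult)
  finally show ?thesis .
qed

text \<open>The second difference at m of k \<mapsto> max(j - k, 0) is 1 if j = m and 0 otherwise.
  It is stated with all terms added to avoid subtraction of naturals; m \<ge> 1 makes m - 1 a
  genuine predecessor.\<close>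

lemma eq_of_weighted_sums_eq:
  fixes \<alpha> \<alpha>' :: "nat \<Rightarrow> nat"
  assumes eq: "\<And>k. (\<Sum>j=1..s. \<alpha> j * (j - k)) = (\<Sum>j=1..s. \<alpha>' j * (j - k))"
    and m: "1 \<le> m" "m \<le> s"
  shows "\<alpha> m = \<alpha>' m"
proof -
  have *: "(\<Sum>j=1..s. \<beta> j * (j - (m - 1))) + (\<Sum>j=1..s. \<beta> j * (j - Suc m)) =
      2 * (\<Sum>j=1..s. \<beta> j * (j - m)) + \<beta> m" for \<beta> :: "nat \<Rightarrow> nat"
  proof -
    have "(\<Sum>j=1..s. \<beta> j * (j - (m - 1))) + (\<Sum>j=1..s. \<beta> j * (j - Suc m)) =
        (\<Sum>j=1..s. 2 * (\<beta> j * (j - m)) + (if j = m then \<beta> j else 0))"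
      unfolding sum.distrib[symmetric]
    proof (rule sum.cong[OF refl])
      fix j
      have "(j - (m - 1)) + (j - Suc m) = 2 * (j - m) + (if j = m then 1 else 0)" using m by auto
      then show "\<beta> j * (j - (m - 1)) + \<beta> j * (j - Suc m) = 2 * (\<beta> j * (j - m)) + (if j = m then \<beta> j else 0)"
        by (simp flip: distrib_left)
    qed
    then show ?thesis using m by (simp add: sum.distrib sum_distrib_left)
  qed
  show ?thesis using *[of \<alpha>] *[of \<alpha>'] unfolding eq by simp
qed

text \<open>The isomorphism and its inverse give linear injections between the reduced parts in both
  directions, so for every k the multiples by \<pi>^k are equally many on both sides. These numbers
  are powers of the same q > 1, so the exponents agree.\<close>

lemma torsion_model_unique:
  assumes \<pi>: "\<pi> \<noteq> 0" "\<not> \<pi> dvd 1" and fin: "finite (range (residue_class \<pi>))"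
    and E: "injective_module type_ring E"
    and iso: "mod_iso type_ring (torsion_model type_ring \<pi> E l s \<alpha>) (torsion_model type_ring \<pi> E l' s \<alpha>')"
    and j: "1 \<le> j" "j \<le> s"
  shows "\<alpha> j = \<alpha>' j"
proof -
  let ?A = "type_ring :: 'a ring"
  define P where "P l = direct_sum {..<l} (\<lambda>_. E)" for l :: nat
  define Q where "Q \<alpha> = direct_sum (SIGMA j:{1..s}. {..<\<alpha> j}) (\<lambda>(j, _). cyclic_quot ?A \<pi> j)"
    for \<alpha> :: "nat \<Rightarrow> nat"
  let ?q = "card (range (residue_class \<pi>))"
  have T: "torsion_model ?A \<pi> E l s \<alpha> = direct_sum2 (P l) (Q \<alpha>)" for l \<alpha>
    by (simp add: torsion_model_def P_def Q_def)
  have EM: "module ?A E" using E by (simp add: injective_module_def)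
  have P: "module ?A (P l)" for l unfolding P_def
    by (rule direct_sum_module) (simp_all add: EM cring_from_type_algebra)
  have Q: "module ?A (Q \<alpha>)" for \<alpha> unfolding Q_def
    by (rule direct_sum_module) (auto simp: cyclic_quot_module cring_from_type_algebra)
  have ann: "(\<pi> ^ s) \<odot>\<^bsub>Q \<alpha>\<^esub> x = \<zero>\<^bsub>Q \<alpha>\<^esub>" if "x \<in> carrier (Q \<alpha>)" for x \<alpha>
  proof -
    have "(\<pi> ^ s) \<odot>\<^bsub>cyclic_quot ?A \<pi> j\<^esub> y = \<zero>\<^bsub>cyclic_quot ?A \<pi> j\<^esub>"
      if y: "y \<in> carrier (cyclic_quot ?A \<pi> j)" and j: "j \<le> s" for y j
    proof -
      obtain x where x: "y = residue_class (\<pi> ^ j) x" using y by (auto simp: carrier_cyclic_quot)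
      have "residue_class (\<pi> ^ j) (\<pi> ^ s * x) = residue_class (\<pi> ^ j) 0"
        using j by (simp add: residue_class_eq_iff le_imp_power_dvd dvd_mult2)
      then show ?thesis
        unfolding x smult_cyclic_quot by (simp add: cyclic_quot_eq quot_module_def residue_class_def)
    qed
    then show ?thesis using that
      by (auto simp: Q_def direct_sum_def PiE_iff split: prod.splits intro!: restrict_ext)
  qed
  have div: "\<exists>f\<in>carrier (P l). e = (\<pi> ^ s) \<odot>\<^bsub>P l\<^esub> f" if e: "e \<in> carrier (P l)" for e l
  proof -
    have "(\<lambda>x. (\<pi> ^ s) \<odot>\<^bsub>P l\<^esub> x) ` carrier (P l) = (\<Pi>\<^sub>E i\<in>{..<l}. (\<lambda>x. (\<pi> ^ s) \<odot>\<^bsub>E\<^esub> x) ` carrier E)"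
      unfolding P_def by (rule smult_image_direct_sum[where A = type_ring]) (simp_all add: cring_from_type_algebra EM)
    moreover have "(\<lambda>x. (\<pi> ^ s) \<odot>\<^bsub>E\<^esub> x) ` carrier E = carrier E"
      using injective_module_divisible[OF E, of "\<pi> ^ s"] \<pi> module.smult_closed[OF EM, of "\<pi> ^ s"]
      by (auto simp: image_iff)
    moreover have "carrier (P l) \<subseteq> (\<Pi>\<^sub>E i\<in>{..<l}. carrier E)" by (auto simp: P_def direct_sum_def)
    ultimately show ?thesis using e by blast
  qed
  \<comment> \<open>A positive \<open>card\<close> certifies finiteness, so the count of residue
    classes modulo \<pi>^j is enough.\<close>
  have finC: "finite (carrier (cyclic_quot ?A \<pi> j))" for j
  proof (rule card_ge_0_finite)
    show "card (carrier (cyclic_quot ?A \<pi> j)) > 0"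
      using fin by (auto simp: carrier_cyclic_quot card_residue_classes_power[OF \<pi>(1)] card_gt_0_iff)
  qed
  have finQ: "finite (carrier (Q \<alpha>))" for \<alpha>
  proof (rule finite_subset)
    show "carrier (Q \<alpha>) \<subseteq> (\<Pi>\<^sub>E i\<in>(SIGMA j:{1..s}. {..<\<alpha> j}). carrier (cyclic_quot ?A \<pi> (fst i)))"
      unfolding Q_def direct_sum_def by (simp add: case_prod_beta Collect_restrict)
    show "finite (\<Pi>\<^sub>E i\<in>(SIGMA j:{1..s}. {..<\<alpha> j}). carrier (cyclic_quot ?A \<pi> (fst i)))"
      using finC by (intro finite_PiE finite_SigmaI) auto
  qed
  \<comment> \<open>The classes of 0 and 1 differ since \<pi> is not a unit. With q > 1, an
    inequality of powers of q is one of exponents.\<close>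
  have q: "?q > 1"
  proof -
    have "residue_class \<pi> 1 \<noteq> residue_class \<pi> 0" using \<pi> by (simp add: residue_class_eq_iff)
    then have "card {residue_class \<pi> 1, residue_class \<pi> 0} = 2" by simp
    moreover have "card {residue_class \<pi> 1, residue_class \<pi> 0} \<le> ?q"
      using fin by (intro card_mono) auto
    ultimately show ?thesis by simp
  qed
  \<comment> \<open>Stated for arbitrary multiplicities so that it applies to the isomorphism and to
    its inverse.\<close>
  have le: "(\<Sum>j=1..s. \<alpha> j * (j - k)) \<le> (\<Sum>j=1..s. \<alpha>' j * (j - k))"
    if hyp: "mod_iso ?A (torsion_model ?A \<pi> E l s \<alpha>) (torsion_model ?A \<pi> E l' s \<alpha>')" for l l' \<alpha> \<alpha>' k
  proof -
    obtain \<psi> where "\<psi> \<in> mod_hom ?A (Q \<alpha>) (Q \<alpha>')" "inj_on \<psi> (carrier (Q \<alpha>))"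
      using inj_hom_of_direct_sum2_iso[OF P Q P Q _ ann div hyp[unfolded T]] by auto
    from card_smult_image_le[OF this finQ Q Q, of "\<pi> ^ k"]
    have "?q ^ (\<Sum>j=1..s. \<alpha> j * (j - k)) \<le> ?q ^ (\<Sum>j=1..s. \<alpha>' j * (j - k))"
      unfolding Q_def card_smult_reduced_part[OF \<pi>(1)] by simp
    then show ?thesis using q by simp
  qed
  have "module ?A (torsion_model ?A \<pi> E l s \<alpha>)" unfolding T by (rule direct_sum2_module[OF P Q])
  then show ?thesis
    using eq_of_weighted_sums_eq[OF antisym[OF le[OF iso] le[OF mod_iso_sym[OF _ iso]]] j] by blast
qed

section \<open>Multidegrees of polynomials and fractions\<close>

definition has_degree :: "nat \<Rightarrow> (nat \<Rightarrow> int) \<Rightarrow> (nat \<Rightarrow>\<^sub>0 nat) \<Rightarrow> bool" where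
  "has_degree n d m \<longleftrightarrow> (\<forall>k\<in>{1..n}. int (Poly_Mapping.lookup m k) = d k)"

lemma carrier_poly_ring: "carrier (poly_ring n) = {f. \<forall>m\<in>Poly_Mapping.keys f. Poly_Mapping.keys m \<subseteq> {1..n}}"
  by (simp add: poly_ring_def)

lemma poly_comp_iff:
  "f \<in> poly_comp n d \<longleftrightarrow>
    (\<forall>m\<in>Poly_Mapping.keys f. Poly_Mapping.keys m \<subseteq> {1..n} \<and> has_degree n d m)"
  by (auto simp: poly_comp_def carrier_poly_ring has_degree_def)

lemma poly_comp_carrier: "f \<in> poly_comp n d \<Longrightarrow> f \<in> carrier (poly_ring n)"
  by (simp add: poly_comp_def)

lemma has_degree_add:
  assumes "has_degree n e m'"
  shows "has_degree n (\<lambda>i. d i + e i) (m + m') \<longleftrightarrow> has_degree n d m"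
  using assms by (auto simp: has_degree_def lookup_add)

lemma poly_comp_cong: "(\<And>k. k \<in> {1..n} \<Longrightarrow> d k = d' k) \<Longrightarrow> poly_comp n d = poly_comp n d'"
  by (auto simp: poly_comp_def)

lemma keys_add_monom: "Poly_Mapping.keys (a + b :: nat \<Rightarrow>\<^sub>0 nat) = Poly_Mapping.keys a \<union> Poly_Mapping.keys b"
  by (auto simp: in_keys_iff lookup_add)

lemma poly_comp_mult:
  assumes "f \<in> poly_comp n d" "g \<in> poly_comp n e"
  shows "f * g \<in> poly_comp n (\<lambda>i. d i + e i)"
  unfolding poly_comp_iff
proof
  fix m assume "m \<in> Poly_Mapping.keys (f * g)"
  then obtain a b where "a \<in> Poly_Mapping.keys f" "b \<in> Poly_Mapping.keys g" "m = a + b"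
    using keys_mult[of f g] by auto
  then show "Poly_Mapping.keys m \<subseteq> {1..n} \<and> has_degree n (\<lambda>i. d i + e i) m"
    using assms has_degree_add[of n e b d a] by (auto simp: poly_comp_iff keys_add_monom)
qed

lemma poly_comp_one: "1 \<in> poly_comp n (\<lambda>_. 0)"
  by (simp add: poly_comp_iff has_degree_def)

lemma poly_comp_power: "f \<in> poly_comp n d \<Longrightarrow> f ^ k \<in> poly_comp n (\<lambda>i. int k * d i)"
proof (induction k)
  case 0
  then show ?case using poly_comp_one by simp
next
  case (Suc k)
  then show ?case using poly_comp_mult[of f n d "f ^ k" "\<lambda>i. int k * d i"] by (simp add: algebra_simps)
qed

lemma poly_comp_add:
  "f \<in> poly_comp n d \<Longrightarrow> g \<in> poly_comp n d \<Longrightarrow> f + g \<in> poly_comp n d"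
  using keys_add[of f g] by (auto simp: poly_comp_iff)

lemma poly_comp_zero: "0 \<in> poly_comp n d"
  by (simp add: poly_comp_iff)

lemma poly_comp_const: "const_pol a \<in> poly_comp n (\<lambda>_. 0)"
  by (auto simp: poly_comp_iff const_pol_def has_degree_def)

lemma carrier_poly_ring_add:
  "f \<in> carrier (poly_ring n) \<Longrightarrow> g \<in> carrier (poly_ring n) \<Longrightarrow> f + g \<in> carrier (poly_ring n)"
  using keys_add[of f g] unfolding carrier_poly_ring by blast

lemma carrier_poly_ring_mult:
  assumes "f \<in> carrier (poly_ring n)" "g \<in> carrier (poly_ring n)"
  shows "f * g \<in> carrier (poly_ring n)"
  unfolding carrier_poly_ring
proof (intro CollectI ballI)
  fix m assume "m \<in> Poly_Mapping.keys (f * g)"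
  then obtain a b where "a \<in> Poly_Mapping.keys f" "b \<in> Poly_Mapping.keys g" "m = a + b"
    using keys_mult[of f g] by auto
  then show "Poly_Mapping.keys m \<subseteq> {1..n}"
    using assms by (auto simp: carrier_poly_ring keys_add_monom)
qed

lemma carrier_poly_ring_power:
  "f \<in> carrier (poly_ring n) \<Longrightarrow> f ^ k \<in> carrier (poly_ring n)"
proof (induction k)
  case 0
  then show ?case using poly_comp_carrier[OF poly_comp_one] by simp
qed (simp add: carrier_poly_ring_mult)

lemma nonzero_key:
  assumes "f \<noteq> 0"
  obtains m where "m \<in> Poly_Mapping.keys f"
  using assms by (metis in_keys_iff lookup_zero poly_mapping_eqI)

section \<open>Projection of polynomials onto a graded piece\<close>

definition hcomp :: "nat \<Rightarrow> (nat \<Rightarrow> int) \<Rightarrow> 'a::idom mpol \<Rightarrow> 'a mpol" where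
  "hcomp n d g = Poly_Mapping.mapp (\<lambda>m c. c when has_degree n d m) g"

lemma lookup_hcomp: "Poly_Mapping.lookup (hcomp n d g) m = (Poly_Mapping.lookup g m when has_degree n d m)"
  by (auto simp: hcomp_def lookup_mapp when_def in_keys_iff)

lemma hcomp_add: "hcomp n d (f + g) = hcomp n d f + hcomp n d g"
  by (rule poly_mapping_eqI) (simp add: lookup_hcomp lookup_add when_add_distrib)

lemma hcomp_poly_comp: "g \<in> carrier (poly_ring n) \<Longrightarrow> hcomp n d g \<in> poly_comp n d"
  by (auto simp: poly_comp_iff carrier_poly_ring in_keys_iff lookup_hcomp)

lemma hcomp_id:
  assumes "\<And>m. m \<in> Poly_Mapping.keys g \<Longrightarrow> has_degree n d m"
  shows "hcomp n d g = g"
  using assms by (intro poly_mapping_eqI) (auto simp: lookup_hcomp when_def in_keys_iff)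

lemma hcomp_eq_0:
  assumes "\<And>m. m \<in> Poly_Mapping.keys g \<Longrightarrow> \<not> has_degree n d m"
  shows "hcomp n d g = 0"
  using assms by (intro poly_mapping_eqI) (auto simp: lookup_hcomp when_def in_keys_iff)

text \<open>Split g into its degree d part and the rest. Multiplication by F raises every degree by
  exactly e, so the first product is homogeneous of degree d + e and the second has no monomial of
  that degree.\<close>

lemma hcomp_mult:
  assumes F: "F \<in> poly_comp n e"
  shows "hcomp n (\<lambda>i. d i + e i) (g * F) = hcomp n d g * F"
proof -
  have *: "\<exists>a\<in>Poly_Mapping.keys g'. has_degree n (\<lambda>i. d i + e i) m \<longleftrightarrow> has_degree n d a"
    if m: "m \<in> Poly_Mapping.keys (g' * F)" for m g'
  proof -
    obtain a b where ab: "a \<in> Poly_Mapping.keys g'" "b \<in> Poly_Mapping.keys F" "m = a + b"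
      using keys_mult[of g' F] m by blast
    then have "has_degree n e b" using F by (simp add: poly_comp_iff)
    then show ?thesis using has_degree_add[of n e b d a] ab by blast
  qed
  let ?g1 = "hcomp n d g" and ?g2 = "g - hcomp n d g"
  have "hcomp n (\<lambda>i. d i + e i) (?g1 * F) = ?g1 * F"
  proof (rule hcomp_id)
    fix m assume "m \<in> Poly_Mapping.keys (?g1 * F)"
    from *[OF this] obtain a where "a \<in> Poly_Mapping.keys ?g1"
      "has_degree n (\<lambda>i. d i + e i) m \<longleftrightarrow> has_degree n d a" by blast
    then show "has_degree n (\<lambda>i. d i + e i) m"
      by (auto simp: in_keys_iff lookup_hcomp)
  qed
  moreover have "hcomp n (\<lambda>i. d i + e i) (?g2 * F) = 0"
  proof (rule hcomp_eq_0)
    fix m assume "m \<in> Poly_Mapping.keys (?g2 * F)"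
    from *[OF this] obtain a where "a \<in> Poly_Mapping.keys ?g2"
      "has_degree n (\<lambda>i. d i + e i) m \<longleftrightarrow> has_degree n d a" by blast
    then show "\<not> has_degree n (\<lambda>i. d i + e i) m"
      by (auto simp: in_keys_iff lookup_hcomp lookup_minus)
  qed
  ultimately have "hcomp n (\<lambda>i. d i + e i) (?g1 * F + ?g2 * F) = ?g1 * F"
    unfolding hcomp_add by (simp only: add.right_neutral)
  moreover have "?g1 * F + ?g2 * F = g * F" by (simp add: algebra_simps)
  ultimately show ?thesis by (simp only:)
qed

section \<open>Projection of fractions onto a graded piece\<close>

definition hfrac :: "nat \<Rightarrow> 'a::idom mpol fract set" where
  "hfrac n = {Fract g F | g F d. F \<noteq> 0 \<and> F \<in> poly_comp n d}"

text \<open>The degree \<open>u\<close> part of a fraction with homogeneous denominator; junk for other fractions.\<close>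

definition frac_comp :: "nat \<Rightarrow> (nat \<Rightarrow> int) \<Rightarrow> 'a::idom mpol fract \<Rightarrow> 'a mpol fract" where
  "frac_comp n u x = (SOME y. \<exists>g F d. F \<noteq> 0 \<and> F \<in> poly_comp n d \<and> x = Fract g F \<and>
     y = Fract (hcomp n (\<lambda>i. u i + d i) g) F)"

text \<open>The chosen value is independent of the representation: if g/F = g'/F', compare the
  components of degree u + d + d' in g F' = g' F and use that F and F' are homogeneous.\<close>

lemma frac_comp_Fract:
  assumes F: "F \<noteq> 0" "F \<in> poly_comp n d"
  shows "frac_comp n u (Fract g F) = Fract (hcomp n (\<lambda>i. u i + d i) g) F"
proof -
  have "\<exists>y g' F' d'. F' \<noteq> 0 \<and> F' \<in> poly_comp n d' \<and> Fract g F = Fract g' F' \<and>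
     y = Fract (hcomp n (\<lambda>i. u i + d' i) g') F'" using F by blast
  from someI_ex[OF this] obtain g' F' d' where *: "F' \<noteq> 0" "F' \<in> poly_comp n d'" "Fract g F = Fract g' F'"
    "frac_comp n u (Fract g F) = Fract (hcomp n (\<lambda>i. u i + d' i) g') F'"
    unfolding frac_comp_def by blast
  have eq: "g * F' = g' * F" using * F by (simp add: eq_fract)
  have "hcomp n (\<lambda>i. u i + d i) g * F' = hcomp n (\<lambda>i. (u i + d i) + d' i) (g * F')"
    by (rule hcomp_mult[OF *(2), symmetric])
  also have "\<dots> = hcomp n (\<lambda>i. (u i + d' i) + d i) (g' * F)"
    by (simp only: eq add.assoc add.commute[of "d x" for x])
  also have "\<dots> = hcomp n (\<lambda>i. u i + d' i) g' * F"
    by (rule hcomp_mult[OF F(2)])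
  finally show ?thesis using * F by (simp add: eq_fract)
qed

lemma frac_comp_add:
  assumes "x \<in> hfrac n" "y \<in> hfrac n"
  shows "x + y \<in> hfrac n" "frac_comp n u (x + y) = frac_comp n u x + frac_comp n u y"
proof -
  obtain g F d where x: "F \<noteq> 0" "F \<in> poly_comp n d" "x = Fract g F"
    using assms(1) by (auto simp: hfrac_def)
  obtain g' F' d' where y: "F' \<noteq> 0" "F' \<in> poly_comp n d'" "y = Fract g' F'"
    using assms(2) by (auto simp: hfrac_def)
  have xy: "x + y = Fract (g * F' + g' * F) (F * F')" using x y by simp
  have FF: "F * F' \<noteq> 0" "F * F' \<in> poly_comp n (\<lambda>i. d i + d' i)" using x y by (auto intro: poly_comp_mult)
  then show "x + y \<in> hfrac n" unfolding xy hfrac_def by blast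
  \<comment> \<open>Over the common denominator F F' of degree d + d', the part of degree u + d + d'
    of each numerator is computed by \<open>hcomp_mult\<close>.\<close>
  have 1: "hcomp n (\<lambda>i. u i + (d i + d' i)) (g * F') = hcomp n (\<lambda>i. u i + d i) g * F'"
    using hcomp_mult[OF y(2), of "\<lambda>i. u i + d i" g] by (simp add: ac_simps)
  have 2: "hcomp n (\<lambda>i. u i + (d i + d' i)) (g' * F) = hcomp n (\<lambda>i. u i + d' i) g' * F"
    using hcomp_mult[OF x(2), of "\<lambda>i. u i + d' i" g'] by (simp add: ac_simps)
  show "frac_comp n u (x + y) = frac_comp n u x + frac_comp n u y"
    unfolding xy frac_comp_Fract[OF FF] hcomp_add 1 2
    using x y by (simp add: frac_comp_Fract[OF x(1,2)] frac_comp_Fract[OF y(1,2)])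
qed

lemma frac_comp_0: "(0 :: 'a::idom mpol fract) \<in> hfrac n" "frac_comp n u (0 :: 'a mpol fract) = 0"
proof -
  have 0: "(0 :: 'a mpol fract) = Fract 0 1" by (simp add: Zero_fract_def)
  have 1: "(1 :: 'a mpol) \<noteq> 0" by simp
  show "(0 :: 'a mpol fract) \<in> hfrac n" unfolding hfrac_def 0 using poly_comp_one 1 by blast
  have "hcomp n d 0 = (0 :: 'a mpol)" for d by (rule hcomp_id) simp
  then show "frac_comp n u (0 :: 'a mpol fract) = 0"
    unfolding 0 frac_comp_Fract[OF 1 poly_comp_one] by simp
qed

lemma frac_comp_uminus:
  assumes "x \<in> hfrac n"
  shows "- x \<in> hfrac n" "frac_comp n u (- x) = - frac_comp n u x"
proof -
  obtain g F d where x: "F \<noteq> 0" "F \<in> poly_comp n d" "x = Fract g F"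
    using assms by (auto simp: hfrac_def)
  show *: "- x \<in> hfrac n" using x unfolding hfrac_def by auto
  have "frac_comp n u (x + - x) = frac_comp n u x + frac_comp n u (- x)"
    by (rule frac_comp_add(2)[OF assms *])
  then show "frac_comp n u (- x) = - frac_comp n u x"
    by (simp add: frac_comp_0 eq_neg_iff_add_eq_0 add.commute)
qed

text \<open>Handles the signs in the Cech differential.\<close>

lemma frac_comp_sign:
  assumes "x \<in> hfrac n"
  shows "(- 1) ^ k * x \<in> hfrac n" "frac_comp n u ((- 1) ^ k * x) = (- 1) ^ k * frac_comp n u x"
  using frac_comp_uminus[OF assms] assms by (cases "even k"; simp)+

lemma frac_comp_sum:
  assumes "finite T" "\<And>j. j \<in> T \<Longrightarrow> f j \<in> hfrac n"
  shows "sum f T \<in> hfrac n \<and> frac_comp n u (sum f T) = (\<Sum>j\<in>T. frac_comp n u (f j))"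
  using assms by (induction T rule: finite_induct) (auto simp: frac_comp_0 frac_comp_add)

section \<open>Graded pieces of localizations\<close>

lemma localization_comp_iff:
  assumes "f \<noteq> 0" "f \<in> poly_comp n d"
  shows "x \<in> localization_comp n f u \<longleftrightarrow>
    (\<exists>g k. x = Fract g (f ^ k) \<and> g \<in> poly_comp n (\<lambda>i. u i + int k * d i))"
proof
  assume "x \<in> localization_comp n f u"
  then obtain g k d' where *: "x = Fract g (f ^ k)" "f \<in> poly_comp n d'"
    "g \<in> poly_comp n (\<lambda>i. u i + int k * d' i)"
    unfolding localization_comp_def by blast
  \<comment> \<open>Any monomial of the nonzero f determines its degree on 1..n, so the degree
    hidden in the definition agrees with d there.\<close>
  obtain m where "m \<in> Poly_Mapping.keys f" using assms(1) by (rule nonzero_key)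
  then have "d' i = d i" if "i \<in> {1..n}" for i
    using assms(2) *(2) that by (auto simp: poly_comp_iff has_degree_def)
  then have "poly_comp n (\<lambda>i. u i + int k * d' i) = poly_comp n (\<lambda>i. u i + int k * d i)"
    by (intro poly_comp_cong) simp
  with * show "\<exists>g k. x = Fract g (f ^ k) \<and> g \<in> poly_comp n (\<lambda>i. u i + int k * d i)" by auto
qed (use assms in \<open>auto simp: localization_comp_def\<close>)

lemma localization_comp_subset: "localization_comp n f u \<subseteq> carrier (localization n f)"
  using poly_comp_carrier by (fastforce simp: localization_comp_def localization_def)

lemma localization_subset_hfrac:
  assumes "f \<noteq> 0" "f \<in> poly_comp n d"
  shows "carrier (localization n f) \<subseteq> hfrac n"
  using poly_comp_power[OF assms(2)] assms(1) unfolding localization_def hfrac_def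
  by auto (metis power_not_zero)

lemma frac_comp_localization:
  assumes f: "f \<noteq> 0" "f \<in> poly_comp n d" and x: "x \<in> carrier (localization n f)"
  shows "frac_comp n u x \<in> localization_comp n f u"
proof -
  obtain g k where x: "x = Fract g (f ^ k)" "g \<in> carrier (poly_ring n)"
    using x by (auto simp: localization_def)
  have "f ^ k \<noteq> 0" using f by simp
  from frac_comp_Fract[OF this poly_comp_power[OF f(2)], of u g] hcomp_poly_comp[OF x(2)]
  show ?thesis unfolding localization_comp_iff[OF f] x(1) by blast
qed

lemma frac_comp_id:
  assumes f: "f \<noteq> 0" "f \<in> poly_comp n d" and x: "x \<in> localization_comp n f u"
  shows "frac_comp n u x = x"
proof -
  obtain g k where x: "x = Fract g (f ^ k)" "g \<in> poly_comp n (\<lambda>i. u i + int k * d i)"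
    using x unfolding localization_comp_iff[OF f] by auto
  have "f ^ k \<noteq> 0" using f by simp
  from frac_comp_Fract[OF this poly_comp_power[OF f(2)], of u g] x
  show ?thesis by (simp add: hcomp_id poly_comp_iff)
qed

lemma localization_comp_add:
  assumes f: "f \<noteq> 0" "f \<in> poly_comp n d"
    and xy: "x \<in> localization_comp n f u" "y \<in> localization_comp n f u"
  shows "x + y \<in> localization_comp n f u"
proof -
  obtain g k where x: "x = Fract g (f ^ k)" "g \<in> poly_comp n (\<lambda>i. u i + int k * d i)"
    using xy unfolding localization_comp_iff[OF f] by auto
  obtain h l where y: "y = Fract h (f ^ l)" "h \<in> poly_comp n (\<lambda>i. u i + int l * d i)"
    using xy unfolding localization_comp_iff[OF f] by auto
  have "x + y = Fract (g * f ^ l + h * f ^ k) (f ^ (k + l))" using f x y by (simp add: power_add)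
  moreover have "g * f ^ l \<in> poly_comp n (\<lambda>i. u i + int (k + l) * d i)"
    using poly_comp_mult[OF x(2) poly_comp_power[OF f(2), of l]] by (simp add: algebra_simps)
  moreover have "h * f ^ k \<in> poly_comp n (\<lambda>i. u i + int (k + l) * d i)"
    using poly_comp_mult[OF y(2) poly_comp_power[OF f(2), of k]] by (simp add: algebra_simps)
  ultimately show ?thesis unfolding localization_comp_iff[OF f] using poly_comp_add by blast
qed

lemma localization_comp_smult:
  assumes f: "f \<noteq> 0" "f \<in> poly_comp n d" and x: "x \<in> localization_comp n f u"
  shows "Fract (const_pol a) 1 * x \<in> localization_comp n f u"
proof -
  obtain g k where x: "x = Fract g (f ^ k)" "g \<in> poly_comp n (\<lambda>i. u i + int k * d i)"
    using x unfolding localization_comp_iff[OF f] by auto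
  then have "Fract (const_pol a) 1 * x = Fract (const_pol a * g) (f ^ k)" by simp
  moreover have "const_pol a * g \<in> poly_comp n (\<lambda>i. u i + int k * d i)"
    using poly_comp_mult[OF poly_comp_const x(2)] by simp
  ultimately show ?thesis unfolding localization_comp_iff[OF f] by blast
qed

lemma localization_comp_zero:
  assumes f: "f \<noteq> 0" "f \<in> poly_comp n d"
  shows "0 \<in> localization_comp n f u"
  unfolding localization_comp_iff[OF f]
  by (intro exI[of _ 0] conjI poly_comp_zero exI[of _ "0::nat"]) (simp add: Zero_fract_def)

lemma localization_closed:
  assumes "f \<noteq> 0" "f \<in> carrier (poly_ring n)"
  shows "x \<in> carrier (localization n f) \<Longrightarrow> y \<in> carrier (localization n f) \<Longrightarrow>
      x + y \<in> carrier (localization n f)"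
    and "x \<in> carrier (localization n f) \<Longrightarrow> Fract (const_pol a) 1 * x \<in> carrier (localization n f)"
    and "0 \<in> carrier (localization n f)"
proof -
  assume "x \<in> carrier (localization n f)" "y \<in> carrier (localization n f)"
  then obtain g k h l where *: "x = Fract g (f ^ k)" "g \<in> carrier (poly_ring n)"
    "y = Fract h (f ^ l)" "h \<in> carrier (poly_ring n)" by (auto simp: localization_def)
  have "x + y = Fract (g * f ^ l + h * f ^ k) (f ^ (k + l))" using assms * by (simp add: power_add)
  moreover have "g * f ^ l + h * f ^ k \<in> carrier (poly_ring n)"
    using * assms by (intro carrier_poly_ring_add carrier_poly_ring_mult carrier_poly_ring_power)
  ultimately show "x + y \<in> carrier (localization n f)" by (auto simp: localization_def)
next
  assume "x \<in> carrier (localization n f)"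
  then obtain g k where *: "x = Fract g (f ^ k)" "g \<in> carrier (poly_ring n)"
    by (auto simp: localization_def)
  have "Fract (const_pol a) 1 * x = Fract (const_pol a * g) (f ^ k)" using * by simp
  moreover have "const_pol a * g \<in> carrier (poly_ring n)"
    using * by (intro carrier_poly_ring_mult poly_comp_carrier[OF poly_comp_const])
  ultimately show "Fract (const_pol a) 1 * x \<in> carrier (localization n f)"
    by (auto simp: localization_def)
next
  have "\<exists>g k. 0 = Fract g (f ^ k) \<and> g \<in> carrier (poly_ring n)"
    using poly_comp_carrier[OF poly_comp_zero] by (intro exI[of _ 0] conjI) (auto simp: fract_collapse)
  then show "0 \<in> carrier (localization n f)" by (simp add: localization_def)
qed

section \<open>Laurent monomials and the shift of degrees\<close>

definition monom_of :: "nat \<Rightarrow> (nat \<Rightarrow> int) \<Rightarrow> (nat \<Rightarrow>\<^sub>0 nat)" where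
  "monom_of n e = (\<Sum>k\<in>{1..n}. Poly_Mapping.single k (nat (e k)))"

lemma lookup_monom_of: "Poly_Mapping.lookup (monom_of n e) k = (if k \<in> {1..n} then nat (e k) else 0)"
  unfolding monom_of_def lookup_sum lookup_single by (simp add: when_def)

lemma keys_monom_of: "Poly_Mapping.keys (monom_of n e) \<subseteq> {1..n}"
  by (auto simp: in_keys_iff lookup_monom_of split: if_splits)

text \<open>This is X^(v-u). As \<open>monom_of\<close> replaces negative exponents by 0, the
  numerator carries the positive part of v - u and the denominator its negative part.\<close>

definition laurent_monom :: "nat \<Rightarrow> (nat \<Rightarrow> int) \<Rightarrow> (nat \<Rightarrow> int) \<Rightarrow> 'a::idom mpol fract" where
  "laurent_monom n u v = Fract (Poly_Mapping.single (monom_of n (\<lambda>k. v k - u k)) 1)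
     (Poly_Mapping.single (monom_of n (\<lambda>k. u k - v k)) 1)"

lemma single_1_neq_0: "Poly_Mapping.single m (1 :: 'a::idom) \<noteq> 0"
  by (metis keys_single keys_zero insert_not_empty one_neq_zero)

lemma laurent_monom_inverse: "laurent_monom n u v * laurent_monom n v u = 1"
  unfolding laurent_monom_def by (simp add: One_fract_def eq_fract(1) single_1_neq_0 mult.commute)

text \<open>The grading is so fine that a nonzero homogeneous numerator is a single term. Over the
  denominator f^(k+K) its exponent is u + (k+K) d, and multiplication by X^(v-u) turns this into v +
  (k+K) d; what has to be checked is that the latter is nonnegative.\<close>

lemma laurent_monom_localization_comp:
  assumes f: "f \<noteq> 0" "f \<in> poly_comp n d" and x: "x \<in> localization_comp n f u"
    and uv: "\<And>r. r \<in> {1..n} \<Longrightarrow> u r < 0 \<longleftrightarrow> v r < 0"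
  shows "laurent_monom n u v * x \<in> localization_comp n f v"
proof (cases "x = 0")
  case True
  then show ?thesis using localization_comp_zero[OF f] by simp
next
  case False
  obtain g k where x: "x = Fract g (f ^ k)" "g \<in> poly_comp n (\<lambda>i. u i + int k * d i)"
    using x unfolding localization_comp_iff[OF f] by auto
  \<comment> \<open>large enough for \<open>v + (k + K) d\<close> to be nonnegative, see \<open>pos\<close> below\<close>
  define K where "K = (\<Sum>r\<in>{1..n}. nat \<bar>v r\<bar>)"
  define h where "h = g * f ^ K"
  have h: "h \<in> poly_comp n (\<lambda>i. u i + int (k + K) * d i)"
    using poly_comp_mult[OF x(2) poly_comp_power[OF f(2), of K]]
    by (simp add: h_def algebra_simps)
  have xh: "x = Fract h (f ^ (k + K))"
    using f by (simp add: x h_def eq_fract power_add mult_ac)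
  have "h \<noteq> 0" using False xh by (auto simp: fract_collapse)
  obtain m where m: "m \<in> Poly_Mapping.keys h" using \<open>h \<noteq> 0\<close> by (rule nonzero_key)
  have mn: "Poly_Mapping.keys m \<subseteq> {1..n}" and
    mdeg: "\<And>r. r \<in> {1..n} \<Longrightarrow> int (Poly_Mapping.lookup m r) = u r + int (k + K) * d r"
    using h m by (auto simp: poly_comp_iff has_degree_def)
  define b where "b = Poly_Mapping.lookup h m"
  \<comment> \<open>The degree fixes the exponents of X_1, ..., X_n and no other variable occurs, so
    every monomial of h equals m.\<close>
  have hm: "h = Poly_Mapping.single m b"
  proof (rule poly_mapping_eqI)
    fix m'
    have "m' = m" if "m' \<in> Poly_Mapping.keys h"
    proof (rule poly_mapping_eqI)
      fix r
      have m': "Poly_Mapping.keys m' \<subseteq> {1..n}" "has_degree n (\<lambda>i. u i + int (k + K) * d i) m'"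
        using h that by (auto simp: poly_comp_iff)
      show "Poly_Mapping.lookup m' r = Poly_Mapping.lookup m r"
      proof (cases "r \<in> {1..n}")
        case True
        then have "int (Poly_Mapping.lookup m' r) = int (Poly_Mapping.lookup m r)"
          using m'(2) mdeg[OF True] by (simp add: has_degree_def)
        then show ?thesis by simp
      next
        case False
        then have "r \<notin> Poly_Mapping.keys m" "r \<notin> Poly_Mapping.keys m'" using m'(1) mn by auto
        then show ?thesis by (simp add: in_keys_iff)
      qed
    qed
    then show "Poly_Mapping.lookup h m' = Poly_Mapping.lookup (Poly_Mapping.single m b) m'"
      by (auto simp: lookup_single when_def b_def in_keys_iff)
  qed
  obtain mf where "mf \<in> Poly_Mapping.keys f" using f(1) by (rule nonzero_key)
  then have d0: "d r \<ge> 0" if "r \<in> {1..n}" for r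
  proof -
    have "d r = int (Poly_Mapping.lookup mf r)"
      using f(2) that \<open>mf \<in> Poly_Mapping.keys f\<close> by (simp add: poly_comp_iff has_degree_def)
    then show ?thesis by simp
  qed
  have pos: "v r + int (k + K) * d r \<ge> 0" if r: "r \<in> {1..n}" for r
  proof (cases "v r \<ge> 0")
    case True
    then show ?thesis using d0[OF r] by simp
  next
    case False
    then have "u r < 0" using uv r by simp
    \<comment> \<open>The sum u_r + (k+K) d_r is an exponent of m and hence nonnegative, whereas u_r
      is negative.\<close>
    have "d r \<noteq> 0"
    proof
      assume "d r = 0"
      then show False using mdeg[OF r] \<open>u r < 0\<close> by simp
    qed
    then have "d r \<ge> 1" using d0[OF r] by simp
    have "nat \<bar>v r\<bar> \<le> K" unfolding K_def using r by (intro member_le_sum) auto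
    then have "- v r \<le> int (k + K)" by simp
    also have "\<dots> \<le> int (k + K) * d r" using \<open>d r \<ge> 1\<close> by (simp add: mult_le_cancel_left1)
    finally show ?thesis by simp
  qed
  let ?m = "monom_of n (\<lambda>i. v i + int (k + K) * d i)"
  let ?p = "monom_of n (\<lambda>k. v k - u k)" and ?q = "monom_of n (\<lambda>k. u k - v k)"
  \<comment> \<open>In each coordinate the truncated exponents of \<open>?p\<close> and
    \<open>?q\<close> differ by v - u, and \<open>pos\<close> ensures that nothing is cut off in
    \<open>?m\<close>.\<close>
  have "?p + m = ?q + ?m"
  proof (rule poly_mapping_eqI)
    fix r
    show "Poly_Mapping.lookup (?p + m) r = Poly_Mapping.lookup (?q + ?m) r"
    proof (cases "r \<in> {1..n}")
      case True
      then show ?thesis using mdeg[OF True] pos[OF True] by (auto simp: lookup_add lookup_monom_of)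
    next
      case False
      then have "r \<notin> Poly_Mapping.keys m" using mn by auto
      then show ?thesis using False by (auto simp: lookup_add lookup_monom_of in_keys_iff)
    qed
  qed
  then have "Poly_Mapping.single ?p 1 * Poly_Mapping.single m b =
      Poly_Mapping.single ?q 1 * Poly_Mapping.single ?m b"
    by (simp only: mult_single mult_1_left)
  then have "laurent_monom n u v * x = Fract (Poly_Mapping.single ?q 1 * Poly_Mapping.single ?m b)
      (Poly_Mapping.single ?q 1 * f ^ (k + K))"
    unfolding laurent_monom_def xh hm by (simp only: mult_fract)
  also have "\<dots> = Fract (Poly_Mapping.single ?m b) (f ^ (k + K))"
    by (rule mult_fract_cancel[OF single_1_neq_0])
  finally have "laurent_monom n u v * x = Fract (Poly_Mapping.single ?m b) (f ^ (k + K))" .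
  moreover have "Poly_Mapping.single ?m b \<in> poly_comp n (\<lambda>i. v i + int (k + K) * d i)"
    using keys_monom_of pos by (auto simp: poly_comp_iff has_degree_def lookup_monom_of split: if_splits)
  ultimately show ?thesis unfolding localization_comp_iff[OF f] by blast
qed

section \<open>Shifting the degree of local cohomology\<close>

definition frac_module :: "('a::idom, 'a mpol fract) module" where
  "frac_module = \<lparr>carrier = UNIV, monoid.mult = undefined, one = undefined,
     ring.zero = 0, add = (+), module.smult = (\<lambda>a x. Fract (const_pol a) 1 * x)\<rparr>"

lemma const_pol_hom: "const_pol (a + b) = const_pol a + const_pol b"
  "const_pol (a * b) = const_pol a * const_pol b" "const_pol 1 = 1"
  by (simp_all add: const_pol_def single_add mult_single)

lemma frac_module_module: "module type_ring (frac_module :: ('a::idom, 'a mpol fract) module)"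
proof (rule moduleI)
  show "cring (type_ring :: 'a ring)" by (rule cring_from_type_algebra)
  show "abelian_group (frac_module :: ('a, 'a mpol fract) module)"
  proof (rule abelian_groupI, goal_cases)
    case (6 x)
    show ?case by (intro bexI[of _ "- x"]) (auto simp: frac_module_def)
  qed (auto simp: frac_module_def)
next
  have "Fract (const_pol a + const_pol b) 1 = Fract (const_pol a) 1 + Fract (const_pol b) 1" for a b :: 'a
    by simp
  then show "(a \<oplus>\<^bsub>type_ring\<^esub> b) \<odot>\<^bsub>frac_module\<^esub> x = a \<odot>\<^bsub>frac_module\<^esub> x \<oplus>\<^bsub>frac_module\<^esub> b \<odot>\<^bsub>frac_module\<^esub> x"
    for a b :: 'a and x
    by (simp add: frac_module_def const_pol_hom distrib_right del: add_fract)
qed (auto simp: frac_module_def const_pol_hom distrib_left One_fract_def[symmetric] simp flip: mult.assoc)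

text \<open>Cohomology is viewed inside the quotient of all fraction-valued cochains by the coboundaries;
  this way the coboundaries need not be known to be cocycles.\<close>

definition all_cochains :: "'a::idom mpol list \<Rightarrow> nat \<Rightarrow> ('a, nat set \<Rightarrow> 'a mpol fract) module" where
  "all_cochains fs i = direct_sum (cech_index fs i) (\<lambda>_. frac_module)"

lemma finite_cech_index: "finite (cech_index fs i)"
  unfolding cech_index_def by (rule finite_subset[of _ "Pow {..<length fs}"]) auto

lemma cech_index_remove: "T \<in> cech_index fs (Suc i) \<Longrightarrow> j \<in> T \<Longrightarrow> T - {j} \<in> cech_index fs i"
  by (auto simp: cech_index_def)

lemma finite_cech_face: "T \<in> cech_index fs i \<Longrightarrow> finite T"
  by (auto simp: cech_index_def intro: finite_subset)

lemma all_cochains_module: "module type_ring (all_cochains fs i)"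
  unfolding all_cochains_def by (intro direct_sum_module cring_from_type_algebra frac_module_module)

lemma carrier_all_cochains: "carrier (all_cochains fs i) = extensional (cech_index fs i)"
  by (auto simp: all_cochains_def direct_sum_def frac_module_def finite_cech_index PiE_def)

lemma all_cochains_simps:
  "\<zero>\<^bsub>all_cochains fs i\<^esub> = (\<lambda>S\<in>cech_index fs i. 0)"
  "c \<oplus>\<^bsub>all_cochains fs i\<^esub> c' = (\<lambda>S\<in>cech_index fs i. c S + c' S)"
  "a \<odot>\<^bsub>all_cochains fs i\<^esub> c = (\<lambda>S\<in>cech_index fs i. Fract (const_pol a) 1 * c S)"
  by (simp_all add: all_cochains_def direct_sum_def frac_module_def)

lemma uminus_all_cochains:
  assumes "c \<in> carrier (all_cochains fs i)"
  shows "\<ominus>\<^bsub>all_cochains fs i\<^esub> c = (- 1) \<odot>\<^bsub>all_cochains fs i\<^esub> c"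
proof -
  interpret module type_ring "all_cochains fs i" by (rule all_cochains_module)
  have "\<ominus>\<^bsub>type_ring\<^esub> (1 :: 'a) = - 1"
    by (rule R.minus_equality) (simp_all)
  then show ?thesis using assms smult_l_minus[of 1 c] smult_one[OF assms] by simp
qed

text \<open>Negation is multiplication by the constant -1, so closure under scalars supplies
  it.\<close>

lemma submodule_all_cochainsI:
  assumes "H \<subseteq> extensional (cech_index fs i)" "(\<lambda>S\<in>cech_index fs i. 0) \<in> H"
    and "\<And>c c'. c \<in> H \<Longrightarrow> c' \<in> H \<Longrightarrow> (\<lambda>S\<in>cech_index fs i. c S + c' S) \<in> H"
    and "\<And>a c. c \<in> H \<Longrightarrow> (\<lambda>S\<in>cech_index fs i. Fract (const_pol a) 1 * c S) \<in> H"
  shows "submodule H type_ring (all_cochains fs i)"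
proof -
  interpret module type_ring "all_cochains fs i" by (rule all_cochains_module)
  show ?thesis
  proof (rule submoduleI, goal_cases)
    case (3 c)
    then have "c \<in> carrier (all_cochains fs i)" using assms(1) by (auto simp: carrier_all_cochains)
    then show ?case using assms(4)[OF 3] by (simp add: uminus_all_cochains all_cochains_simps)
  qed (use assms in \<open>auto simp: carrier_all_cochains all_cochains_simps\<close>)
qed

section \<open>The Cech complex of a list of homogeneous elements\<close>

definition homogeneous_list :: "nat \<Rightarrow> 'a::idom mpol list \<Rightarrow> bool" where
  "homogeneous_list n fs \<longleftrightarrow> (\<forall>f\<in>set fs. f \<noteq> 0 \<and> (\<exists>d. f \<in> poly_comp n d))"

lemma gen_prod:
  assumes "homogeneous_list n fs" "S \<in> cech_index fs i"
  shows "gen_prod fs S \<noteq> 0" "\<exists>d. gen_prod fs S \<in> poly_comp n d"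
proof -
  have "finite S" using assms(2) by (rule finite_cech_face)
  moreover have "\<forall>j\<in>S. fs ! j \<noteq> 0 \<and> (\<exists>d. fs ! j \<in> poly_comp n d)"
  proof
    fix j assume "j \<in> S"
    then have "fs ! j \<in> set fs" using assms(2) by (auto simp: cech_index_def)
    then show "fs ! j \<noteq> 0 \<and> (\<exists>d. fs ! j \<in> poly_comp n d)"
      using assms(1) by (simp add: homogeneous_list_def)
  qed
  ultimately have "gen_prod fs S \<noteq> 0 \<and> (\<exists>d. gen_prod fs S \<in> poly_comp n d)"
    unfolding gen_prod_def
  proof (induction S rule: finite_induct)
    case empty
    then show ?case using poly_comp_one by auto
  next
    case (insert j S)
    then obtain d e where "fs ! j \<in> poly_comp n d" "(\<Prod>j\<in>S. fs ! j) \<in> poly_comp n e" by auto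
    from poly_comp_mult[OF this] insert show ?case by auto
  qed
  then show "gen_prod fs S \<noteq> 0" "\<exists>d. gen_prod fs S \<in> poly_comp n d" by auto
qed

lemma carrier_cech:
  "carrier (cech n fs i) = (\<Pi>\<^sub>E S\<in>cech_index fs i. carrier (localization n (gen_prod fs S)))"
  by (auto simp: cech_def direct_sum_def finite_cech_index)

text \<open>The factor w may be any fraction: constants give linearity over the coefficient ring,
  Laurent monomials give compatibility with the shift of degrees.\<close>

lemma cech_diff_linear:
  "cech_diff fs i (\<lambda>S\<in>cech_index fs i. c S + c' S) =
    (\<lambda>S\<in>cech_index fs (Suc i). cech_diff fs i c S + cech_diff fs i c' S)"
  "cech_diff fs i (\<lambda>S\<in>cech_index fs i. w * c S) =
    (\<lambda>S\<in>cech_index fs (Suc i). w * cech_diff fs i c S)"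
  "cech_diff fs i (\<lambda>S\<in>cech_index fs i. 0) = (\<lambda>S\<in>cech_index fs (Suc i). 0)"
  by (auto simp: cech_diff_def cech_index_remove distrib_left sum.distrib sum_distrib_left
      mult.left_commute intro!: restrict_ext)

lemma cech_closed:
  assumes "homogeneous_list n fs"
  shows "c \<in> carrier (cech n fs i) \<Longrightarrow> c' \<in> carrier (cech n fs i) \<Longrightarrow>
      (\<lambda>S\<in>cech_index fs i. c S + c' S) \<in> carrier (cech n fs i)"
    and "c \<in> carrier (cech n fs i) \<Longrightarrow>
      (\<lambda>S\<in>cech_index fs i. Fract (const_pol a) 1 * c S) \<in> carrier (cech n fs i)"
    and "(\<lambda>S\<in>cech_index fs i. 0) \<in> carrier (cech n fs i)"
proof -
  have gp: "gen_prod fs S \<noteq> 0" "gen_prod fs S \<in> carrier (poly_ring n)"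
    if "S \<in> cech_index fs i" for S
    using gen_prod[OF assms that] poly_comp_carrier by auto
  note cl = localization_closed[OF gp]
  show "c \<in> carrier (cech n fs i) \<Longrightarrow> c' \<in> carrier (cech n fs i) \<Longrightarrow>
      (\<lambda>S\<in>cech_index fs i. c S + c' S) \<in> carrier (cech n fs i)"
    and "c \<in> carrier (cech n fs i) \<Longrightarrow>
      (\<lambda>S\<in>cech_index fs i. Fract (const_pol a) 1 * c S) \<in> carrier (cech n fs i)"
    and "(\<lambda>S\<in>cech_index fs i. 0) \<in> carrier (cech n fs i)"
    unfolding carrier_cech PiE_iff by (auto intro: cl)
qed

text \<open>In degree 0 this is the zero submodule, in higher degrees the image of a Cech term under
  the linear differential.\<close>

lemma coboundaries_submodule:
  assumes "homogeneous_list n fs"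
  shows "submodule (coboundaries n fs i) type_ring (all_cochains fs i)"
proof (cases i)
  case 0
  show ?thesis
    by (rule submodule_all_cochainsI)
      (auto simp: 0 coboundaries_def cech_def direct_sum_def localization_def intro!: restrict_ext)
next
  case (Suc k)
  show ?thesis
  proof (rule submodule_all_cochainsI, goal_cases)
    case 1
    then show ?case by (auto simp: Suc coboundaries_def cech_diff_def)
  next
    case 2
    show ?case
      using cech_closed(3)[OF assms, of k] cech_diff_linear(3)[of fs k]
      by (auto simp: Suc coboundaries_def intro!: image_eqI)
  next
    case (3 c c')
    then obtain b b' where "b \<in> carrier (cech n fs k)" "b' \<in> carrier (cech n fs k)"
      "c = cech_diff fs k b" "c' = cech_diff fs k b'" by (auto simp: Suc coboundaries_def)
    then show ?case
      using image_eqI[where f = "cech_diff fs k", OF cech_diff_linear(1)[of fs k b b', symmetric] cech_closed(1)[OF assms, of b k b']]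
      by (simp add: Suc coboundaries_def)
  next
    case (4 a c)
    then obtain b where "b \<in> carrier (cech n fs k)"
      "c = cech_diff fs k b" by (auto simp: Suc coboundaries_def)
    then show ?case
      using image_eqI[where f = "cech_diff fs k",
          OF cech_diff_linear(2)[of fs k "Fract (const_pol a) 1" b, symmetric] cech_closed(2)[OF assms, of b k a]]
      by (simp add: Suc coboundaries_def)
  qed
qed

section \<open>Homogeneous cocycles and the graded pieces of cohomology\<close>

definition hom_cocycles :: "nat \<Rightarrow> 'a::idom mpol list \<Rightarrow> nat \<Rightarrow> (nat \<Rightarrow> int) \<Rightarrow> (nat set \<Rightarrow> 'a mpol fract) set"
  where "hom_cocycles n fs i u =
    {c \<in> cocycles n fs i. \<forall>S\<in>cech_index fs i. c S \<in> localization_comp n (gen_prod fs S) u}"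

lemma zero_cech: "\<zero>\<^bsub>cech n fs i\<^esub> = (\<lambda>S\<in>cech_index fs i. 0)"
  by (simp add: cech_def direct_sum_def localization_def)

text \<open>Entries in a graded piece already lie in the localization, so of the membership in the
  Cech term only extensionality remains.\<close>

lemma hom_cocycles_eq:
  "hom_cocycles n fs i u = {c \<in> extensional (cech_index fs i).
     cech_diff fs i c = (\<lambda>S\<in>cech_index fs (Suc i). 0) \<and>
     (\<forall>S\<in>cech_index fs i. c S \<in> localization_comp n (gen_prod fs S) u)}"
  using localization_comp_subset
  by (fastforce simp: hom_cocycles_def cocycles_def carrier_cech zero_cech PiE_iff)

lemma hom_cocycles_submodule:
  assumes "homogeneous_list n fs"
  shows "submodule (hom_cocycles n fs i u) type_ring (all_cochains fs i)"
proof (rule submodule_all_cochainsI, goal_cases)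
  case 1
  then show ?case by (auto simp: hom_cocycles_eq)
next
  case 2
  have "0 \<in> localization_comp n (gen_prod fs S) u" if "S \<in> cech_index fs i" for S
    using gen_prod[OF assms that] localization_comp_zero by blast
  then show ?case by (auto simp: hom_cocycles_eq cech_diff_linear)
next
  case (3 c c')
  then have "c S + c' S \<in> localization_comp n (gen_prod fs S) u" if "S \<in> cech_index fs i" for S
    using gen_prod[OF assms that] localization_comp_add that by (fastforce simp: hom_cocycles_eq)
  then show ?case using 3 by (auto simp: hom_cocycles_eq cech_diff_linear intro!: restrict_ext)
next
  case (4 a c)
  then have "Fract (const_pol a) 1 * c S \<in> localization_comp n (gen_prod fs S) u" if "S \<in> cech_index fs i" for S
    using gen_prod[OF assms that] localization_comp_smult that by (fastforce simp: hom_cocycles_eq)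
  then show ?case using 4 by (auto simp: hom_cocycles_eq cech_diff_linear intro!: restrict_ext)
qed

text \<open>Cosets, their sums and their multiples by constants depend only on addition and scalar
  multiplication, which the Cech term shares with \<open>all_cochains\<close>. The graded piece thus
  becomes a subquotient to which \<open>mod_iso_subquotients\<close> applies.\<close>

lemma local_cohomology_comp_eq:
  "local_cohomology_comp n fs i u =
    (quot_module (all_cochains fs i) (coboundaries n fs i))
      \<lparr>carrier := (\<lambda>c. coboundaries n fs i +>\<^bsub>all_cochains fs i\<^esub> c) ` hom_cocycles n fs i u\<rparr>"
proof -
  have add: "add (cech n fs i) = add (all_cochains fs i)"
    by (simp add: cech_def all_cochains_def direct_sum_def localization_def frac_module_def)
  have smult: "const_pol a \<odot>\<^bsub>cech n fs i\<^esub> c = a \<odot>\<^bsub>all_cochains fs i\<^esub> c" for a c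
    by (simp add: cech_def all_cochains_def direct_sum_def localization_def frac_module_def)
  have coset: "H +>\<^bsub>cech n fs i\<^esub> c = H +>\<^bsub>all_cochains fs i\<^esub> c" for H c
    by (simp add: a_r_coset_def r_coset_def add)
  have "set_add ((cech n fs i)\<lparr>carrier := cocycles n fs i\<rparr>) = set_add (all_cochains fs i)"
    by (simp add: set_add_def set_mult_def add fun_eq_iff)
  moreover have "{coboundaries n fs i +>\<^bsub>cech n fs i\<^esub> c | c. c \<in> cocycles n fs i \<and>
      (\<forall>S\<in>cech_index fs i. c S \<in> localization_comp n (gen_prod fs S) u)} =
     (\<lambda>c. coboundaries n fs i +>\<^bsub>all_cochains fs i\<^esub> c) ` hom_cocycles n fs i u"
    by (auto simp: hom_cocycles_def coset)
  ultimately show ?thesis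
    by (simp add: local_cohomology_comp_def local_cohomology_def restrict_scalars_def quot_module_def
        smult coset)
qed

section \<open>The action of Laurent monomials on cohomology\<close>

lemma scale_mod_hom:
  "(\<lambda>c. \<lambda>S\<in>cech_index fs i. w * c S) \<in> mod_hom type_ring (all_cochains fs i) (all_cochains fs i)"
  by (auto simp: mod_hom_def carrier_all_cochains all_cochains_simps distrib_left mult.left_commute
      intro!: restrict_ext)

lemma laurent_monom_hom_cocycles:
  assumes "homogeneous_list n fs" and uv: "\<And>r. r \<in> {1..n} \<Longrightarrow> u r < 0 \<longleftrightarrow> v r < 0"
    and c: "c \<in> hom_cocycles n fs i u"
  shows "(\<lambda>S\<in>cech_index fs i. laurent_monom n u v * c S) \<in> hom_cocycles n fs i v"
proof -
  have "laurent_monom n u v * c S \<in> localization_comp n (gen_prod fs S) v" if S: "S \<in> cech_index fs i" for S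
  proof -
    obtain d where "gen_prod fs S \<in> poly_comp n d" using gen_prod[OF assms(1) S] by blast
    from laurent_monom_localization_comp[OF gen_prod(1)[OF assms(1) S] this _ uv] c S
    show ?thesis by (simp add: hom_cocycles_eq)
  qed
  then show ?thesis using c by (auto simp: hom_cocycles_eq cech_diff_linear intro!: restrict_ext)
qed

text \<open>The differential is a signed sum of entries with homogeneous denominators, on which
  taking the degree u part is additive.\<close>

lemma frac_comp_cech_diff:
  assumes "homogeneous_list n fs" and b: "b \<in> carrier (cech n fs k)" and T: "T \<in> cech_index fs (Suc k)"
  shows "frac_comp n u (cech_diff fs k b T) = cech_diff fs k (\<lambda>S\<in>cech_index fs k. frac_comp n u (b S)) T"
proof -
  have bh: "b (T - {j}) \<in> hfrac n" if "j \<in> T" for j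
  proof -
    have S: "T - {j} \<in> cech_index fs k" using T that by (rule cech_index_remove)
    obtain d where "gen_prod fs (T - {j}) \<in> poly_comp n d" using gen_prod[OF assms(1) S] by blast
    from localization_subset_hfrac[OF gen_prod(1)[OF assms(1) S] this] S b
    show ?thesis by (auto simp: carrier_cech)
  qed
  have "frac_comp n u (cech_diff fs k b T) =
      (\<Sum>j\<in>T. frac_comp n u ((- 1) ^ card {k \<in> T. k < j} * b (T - {j})))"
    using T frac_comp_sum[OF finite_cech_face[OF T], of "\<lambda>j. (- 1) ^ card {k \<in> T. k < j} * b (T - {j})" n u]
      frac_comp_sign(1)[OF bh] by (simp add: cech_diff_def)
  also have "\<dots> = (\<Sum>j\<in>T. (- 1) ^ card {k \<in> T. k < j} * frac_comp n u (b (T - {j})))"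
    by (intro sum.cong refl frac_comp_sign(2) bh)
  also have "\<dots> = cech_diff fs k (\<lambda>S\<in>cech_index fs k. frac_comp n u (b S)) T"
    using T by (simp add: cech_diff_def cech_index_remove)
  finally show ?thesis .
qed

text \<open>Multiplication by X^(v-u) is controlled on graded pieces only and need not map a whole
  localization into itself, so a preimage under the differential has to be made homogeneous before
  it is shifted.\<close>

lemma laurent_monom_coboundaries:
  assumes "homogeneous_list n fs" and uv: "\<And>r. r \<in> {1..n} \<Longrightarrow> u r < 0 \<longleftrightarrow> v r < 0"
    and c: "c \<in> hom_cocycles n fs i u" "c \<in> coboundaries n fs i"
  shows "(\<lambda>S\<in>cech_index fs i. laurent_monom n u v * c S) \<in> coboundaries n fs i"
proof (cases i)
  case 0
  then show ?thesis using c(2) by (auto simp: coboundaries_def zero_cech intro!: restrict_ext)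
next
  case (Suc k)
  then obtain b where b: "b \<in> carrier (cech n fs k)" "c = cech_diff fs k b"
    using c(2) by (auto simp: coboundaries_def)
  \<comment> \<open>A preimage of a homogeneous cochain may be replaced by its homogeneous part.\<close>
  define b' where "b' = (\<lambda>S\<in>cech_index fs k. frac_comp n u (b S))"
  have "c = cech_diff fs k b'"
  proof (rule extensionalityI[of _ "cech_index fs (Suc k)"])
    fix T assume T: "T \<in> cech_index fs (Suc k)"
    obtain d where "gen_prod fs T \<in> poly_comp n d" using gen_prod[OF assms(1) T] by blast
    from frac_comp_id[OF gen_prod(1)[OF assms(1) T] this] c(1) T
    \<comment> \<open>Being homogeneous of degree u, the cochain c is unchanged by the projection,
      which commutes with the differential.\<close>
    have "c T = frac_comp n u (c T)" by (simp add: hom_cocycles_eq Suc)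
    then show "c T = cech_diff fs k b' T"
      using frac_comp_cech_diff[OF assms(1) b(1) T, of u] by (simp add: b(2) b'_def)
  qed (auto simp: b(2) cech_diff_def)
  then have "(\<lambda>S\<in>cech_index fs i. laurent_monom n u v * c S) =
      cech_diff fs k (\<lambda>S\<in>cech_index fs k. laurent_monom n u v * b' S)"
    by (simp add: cech_diff_linear Suc)
  moreover have "(\<lambda>S\<in>cech_index fs k. laurent_monom n u v * b' S) \<in> carrier (cech n fs k)"
    unfolding carrier_cech
  proof (rule restrict_PiE_iff[THEN iffD2], rule ballI)
    fix S assume S: "S \<in> cech_index fs k"
    obtain d where d: "gen_prod fs S \<in> poly_comp n d" using gen_prod[OF assms(1) S] by blast
    have "b S \<in> carrier (localization n (gen_prod fs S))" using b S by (auto simp: carrier_cech)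
    from frac_comp_localization[OF gen_prod(1)[OF assms(1) S] d this]
    have "laurent_monom n u v * b' S \<in> localization_comp n (gen_prod fs S) v"
      using laurent_monom_localization_comp[OF gen_prod(1)[OF assms(1) S] d _ uv] S by (simp add: b'_def)
    then show "laurent_monom n u v * b' S \<in> carrier (localization n (gen_prod fs S))"
      using localization_comp_subset by blast
  qed
  ultimately show ?thesis by (auto simp: Suc coboundaries_def)
qed

lemma local_cohomology_comp_module:
  assumes "homogeneous_list n fs"
  shows "module type_ring (local_cohomology_comp n fs i u)"
  unfolding local_cohomology_comp_eq
  by (intro submodule_quot_module all_cochains_module coboundaries_submodule hom_cocycles_submodule assms)

text \<open>Multiplications by X^(v-u) and X^(u-v) are inverse to each other on homogeneous
  cocycles, and both carry homogeneous coboundaries to coboundaries.\<close>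

lemma local_cohomology_comp_iso:
  assumes "homogeneous_list n fs" and uv: "\<And>r. r \<in> {1..n} \<Longrightarrow> u r < 0 \<longleftrightarrow> v r < 0"
  shows "mod_iso type_ring (local_cohomology_comp n fs i u) (local_cohomology_comp n fs i v)"
proof -
  have vu: "\<And>r. r \<in> {1..n} \<Longrightarrow> v r < 0 \<longleftrightarrow> u r < 0" using uv by simp
  have inv: "(\<lambda>S\<in>cech_index fs i. laurent_monom n u v * (\<lambda>S\<in>cech_index fs i. laurent_monom n v u * c S) S) = c"
    if "c \<in> hom_cocycles n fs i w" for c u v w
    using that by (auto simp: hom_cocycles_eq extensional_def fun_eq_iff laurent_monom_inverse simp flip: mult.assoc)
  show ?thesis
    unfolding local_cohomology_comp_eq
  proof (rule mod_iso_subquotients[OF all_cochains_module coboundaries_submodule[OF assms(1)]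
        hom_cocycles_submodule[OF assms(1)] hom_cocycles_submodule[OF assms(1)]
        scale_mod_hom[where w = "laurent_monom n u v"] scale_mod_hom[where w = "laurent_monom n v u"]], goal_cases)
    case (1 c)
    show ?case by (intro laurent_monom_hom_cocycles assms(1) uv 1)
  next
    case (2 c)
    show ?case by (intro laurent_monom_hom_cocycles assms(1) vu 2)
  next
    case (3 c)
    then show ?case by (rule inv)
  next
    case (4 c)
    then show ?case by (rule inv)
  next
    case (5 c)
    show ?case by (intro laurent_monom_coboundaries assms(1) uv 5)
  next
    case (6 c)
    show ?case by (intro laurent_monom_coboundaries assms(1) vu 6)
  qed
qed

section \<open>The residue field and the comparison within a block\<close>

lemma range_residue_class:
  "range (residue_class \<pi>) = carrier (type_ring Quot (PIdl\<^bsub>type_ring\<^esub> \<pi>))"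
proof -
  have "PIdl\<^bsub>type_ring\<^esub> \<pi> +>\<^bsub>type_ring\<^esub> x = residue_class \<pi> x" for x
  proof -
    have "PIdl\<^bsub>type_ring\<^esub> \<pi> +>\<^bsub>type_ring\<^esub> x = {z. \<pi> dvd z} +>\<^bsub>regular_module type_ring\<^esub> x"
      by (simp add: PIdl_type_ring a_r_coset_def r_coset_def regular_module_def)
    then show ?thesis by (simp only: coset_regular_module)
  qed
  then show ?thesis
    by (auto simp: FactRing_def A_RCOSETS_def RCOSETS_def a_r_coset_def)
qed

theorem theoremD:
  fixes A :: "'a::idom ring" and \<pi> :: 'a and p n i s j :: nat
    and I :: "'a mpol set" and fs :: "'a mpol list"
    and E :: "('a, 'e) module"
    and M :: "(nat \<Rightarrow> int) \<Rightarrow> ('a, (nat set \<Rightarrow> 'a mpol fract) set) module"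
    and l :: "(nat \<Rightarrow> int) \<Rightarrow> nat" and \<alpha> :: "(nat \<Rightarrow> int) \<Rightarrow> nat \<Rightarrow> nat"
    and U :: "nat set"
  assumes "A = ring_of_type_algebra"
    and "complete_dvr_mixed_char A \<pi> p"
    and "finite (carrier (A Quot (PIdl\<^bsub>A\<^esub> \<pi>)))"
    and "C_monomial n I"
    and "homogeneous_generators n I fs"
    and "M = local_cohomology_comp n fs i"
    and "injective_hull A (cyclic_quot A \<pi> 1) E"
    and "s \<in> insert 0 {\<beta>. 1 \<le> \<beta> \<and>
           (\<exists>u\<in>multidegrees n. direct_summand A (cyclic_quot A \<pi> \<beta>) (torsion_part A \<pi> (M u)))}"
    and "\<forall>\<beta>\<ge>1. (\<exists>u\<in>multidegrees n.
           direct_summand A (cyclic_quot A \<pi> \<beta>) (torsion_part A \<pi> (M u))) \<longrightarrow> \<beta> \<le> s"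
    and "\<forall>u\<in>multidegrees n.
           mod_iso A (torsion_part A \<pi> (M u)) (torsion_model A \<pi> E (l u) s (\<alpha> u))"
    and "1 \<le> j" and "j \<le> s"
    and "U \<subseteq> {1..n}"
  shows "\<forall>u\<in>block n U. \<forall>v\<in>block n U. \<alpha> u j = \<alpha> v j"
proof (intro ballI)
  fix u v assume uv: "u \<in> block n U" "v \<in> block n U"
  note A = \<open>A = ring_of_type_algebra\<close>
  have dvr: "\<pi> \<noteq> 0" "maximalideal (PIdl\<^bsub>A\<^esub> \<pi>) A"
    using assms(2) by (auto simp: complete_dvr_mixed_char_def discrete_valuation_ring_def A)
  \<comment> \<open>If \<pi> were a unit, its ideal would be the whole ring and not maximal.\<close>
  have "\<not> \<pi> dvd 1"
  proof
    assume "\<pi> dvd 1"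
    then have "PIdl\<^bsub>A\<^esub> \<pi> = carrier A" by (auto simp: A PIdl_type_ring intro: dvd_trans)
    with maximalideal.I_notcarr[OF dvr(2)] show False by simp
  qed
  \<comment> \<open>Finiteness of the residue field, expressed through residue classes, makes the
    reduced parts finite and the counting meaningful.\<close>
  have fin: "finite (range (residue_class \<pi>))" using assms(3) by (simp add: range_residue_class A)
  have E: "injective_module A E" using assms(7) by (simp add: injective_hull_def)
  have fs: "homogeneous_list n fs" using assms(5) by (auto simp: homogeneous_generators_def homogeneous_list_def)
  have M: "module A (M w)" for w unfolding assms(6) A by (rule local_cohomology_comp_module[OF fs])
  have mem: "u \<in> multidegrees n" "v \<in> multidegrees n" using uv by (simp_all add: block_def)
  \<comment> \<open>Within a block the sign pattern is fixed by U: coordinate r is negative exactly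
    when r is not in U.\<close>
  have "u r < 0 \<longleftrightarrow> v r < 0" if "r \<in> {1..n}" for r
    using uv that by (cases "r \<in> U") (force simp: block_def)+
  then have "mod_iso A (M u) (M v)"
    unfolding assms(6) A by (rule local_cohomology_comp_iso[OF fs])
  then have t: "mod_iso A (torsion_part A \<pi> (M u)) (torsion_part A \<pi> (M v))"
    by (intro mod_iso_torsion_part M) (simp_all add: A)
  have pi: "\<pi> \<in> carrier A" by (simp add: A)
  note iso = assms(10)[rule_format]
  \<comment> \<open>The two models are linked through the torsion parts of M u and M v.\<close>
  from mod_iso_trans[OF mod_iso_sym[OF torsion_part_module[OF M pi] iso[OF mem(1)]]
      mod_iso_trans[OF t iso[OF mem(2)]]]
  have "mod_iso A (torsion_model A \<pi> E (l u) s (\<alpha> u)) (torsion_model A \<pi> E (l v) s (\<alpha> v))" .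
  from torsion_model_unique[OF dvr(1) \<open>\<not> \<pi> dvd 1\<close> fin E[unfolded A] this[unfolded A] assms(11,12)]
  show "\<alpha> u j = \<alpha> v j" .
qed

end
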